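(* Let $G$ be a finite simple bridgeless claw-free cubic graph. Then $G$ admits a $2$-bisection; that is, there is a partition of $V(G)$ into two disjoint subsets $\mathcal{B}$ and $\mathcal{W}$ with $|\mathcal{B}| = |\mathcal{W}|$ such that every connected component of each of the two induced subgraphs $G[\mathcal{B}]$ and $G[\mathcal{W}]$ has at most $2$ vertices.
   Context: All graphs are finite and simple (no loops or multiple edges). A graph is cubic if every vertex has degree $3$, and bridgeless if it has no edge whose removal increases the number of connected components. The claw is the complete bipartite graph $K_{1,3}$; a graph is claw-free if it has no induced subgraph isomorphic to the claw. For a positive integer $k$, a $k$-bisection of a graph $G$ is a (not necessarily proper) $2$-colouring of $V(G)$ with colour classes $\mathcal{B}$ and $\mathcal{W}$ such that (i) $|\mathcal{B}| = |\mathcal{W}|$, and (ii) each monochromatic component, i.e. each connected component of the subgraphs of $G$ induced by $\mathcal{B}$ and by $\mathcal{W}$, has at most $k$ vertices. *)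

theory Defs
  imports "Graph_Theory.Graph_Theory"
begin

text \<open>
  A finite simple graph is a \<^locale>\<open>pair_graph\<close>: a finite vertex set with a symmetric, irreflexive
  set of ordered pairs. An undirected edge $uv$ is thus represented by the two arcs $(u,v)$ and
  $(v,u)$, and the degree of a vertex is its out-degree. The null graph is allowed.
\<close>

definition components :: "('a, 'b) pre_digraph \<Rightarrow> ('a, 'b) pre_digraph set" where
  "components G = {H. pre_digraph.max_subgraph G connected H}"

definition cubic :: "('a, 'b) pre_digraph \<Rightarrow> bool" where
  "cubic G \<longleftrightarrow> (\<forall>v \<in> verts G. out_degree G v = 3)"

definition del_edge :: "'a pair_pre_digraph \<Rightarrow> 'a \<Rightarrow> 'a \<Rightarrow> 'a pair_pre_digraph" where
  "del_edge G u v = G\<lparr>parcs := parcs G - {(u, v), (v, u)}\<rparr>"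

definition bridge :: "'a pair_pre_digraph \<Rightarrow> 'a \<Rightarrow> 'a \<Rightarrow> bool" where
  "bridge G u v \<longleftrightarrow> (u, v) \<in> parcs G \<and>
     card (components (with_proj G)) < card (components (with_proj (del_edge G u v)))"

definition bridgeless :: "'a pair_pre_digraph \<Rightarrow> bool" where
  "bridgeless G \<longleftrightarrow> (\<nexists>u v. bridge G u v)"

text \<open>The library's \<open>K\<^bsub>1,3\<^esub>\<close> is a predicate that holds of every graph isomorphic to the claw.\<close>

definition claw_free :: "('a, 'b) pre_digraph \<Rightarrow> bool" where
  "claw_free G \<longleftrightarrow> (\<nexists>H. induced_subgraph H G \<and> K\<^bsub>1,3\<^esub> H)"

definition bisection :: "nat \<Rightarrow> ('a, 'b) pre_digraph \<Rightarrow> 'a set \<Rightarrow> 'a set \<Rightarrow> bool" where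
  "bisection k G B W \<longleftrightarrow>
     B \<union> W = verts G \<and> B \<inter> W = {} \<and> card B = card W \<and>
     (\<forall>C \<in> components (G \<restriction> B) \<union> components (G \<restriction> W). card (verts C) \<le> k)"

end

theory Submission
  imports Defs
begin

text \<open>
  Every vertex of a claw-free cubic graph lies in a triangle, so the graph consists of disjoint
  triangles, diamonds and tetrahedra joined by a matching of external edges. Contracting them gives a
  bridgeless multigraph with degrees 3 (triangles) and 2 (diamonds). It is enough to two-colour the
  ends of the external edges so that each triangle is split 2 to 1, the majority colours of the
  triangles balance out, and an external edge is monochromatic only if both its ends are alone with
  their colour in their triangle. By induction such a colouring exists with any prescribed external
  edge \<open>f\<close> bichromatic. Diamonds are suppressed, and two triangles joined by several edges are
  suppressed together. Otherwise pick a triangle at \<open>f\<close> and an edge other than \<open>f\<close> from it to another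
  triangle, delete both triangles and join the four loose ends in pairs. By Frink's argument one of
  the two relevant pairings keeps the multigraph bridgeless. A colouring of the smaller
  multigraph in which the edge replacing \<open>f\<close> is bichromatic extends.
\<close>

section \<open>Port systems\<close>

text \<open>Half-edges accommodate the parallel edges and loops that reductions may create, and they
  give the two ends of an edge separate colours. Bridgelessness is kept as a condition on cuts, so a
  reduction is justified by comparing cuts; connectivity enters only in the final translation. Two
  triangles have to disappear together because a triangle split 2 to 1 has an odd imbalance, whereas
  the two middle vertices of a diamond can always be coloured to balance it. Since the edge removed
  between the two triangles is not \<open>f\<close>, the outer half of \<open>f\<close> survives as
  half of a new edge, and the induction hypothesis can prescribe that edge. The two relevant
  pairings are those that join each loose end of one triangle to a loose end of the other.\<close>

definition block :: "'a set \<Rightarrow> ('a \<Rightarrow> 'b) \<Rightarrow> 'a \<Rightarrow> 'a set" where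
  "block P bl p = {q \<in> P. bl q = bl p}"

text \<open>Only the half lying in \<open>X\<close> is collected, so every edge leaving
  \<open>X\<close> is counted once and a cut of size 1 is a bridge.\<close>

definition cut :: "'a set \<Rightarrow> ('a \<Rightarrow> 'a) \<Rightarrow> ('a \<Rightarrow> 'b) \<Rightarrow> 'b set \<Rightarrow> 'a set" where
  "cut P \<pi> bl X = {p \<in> P. bl p \<in> X \<and> bl (\<pi> p) \<notin> X}"

text \<open>
  A port system encodes a bridgeless multigraph with vertices of degree 2 and 3 whose edges have been
  cut in half: a port is a half-edge, \<open>\<pi>\<close> maps it to the other half, and ports carry the same label
  iff they belong to the same vertex. Vertices of degree 3 stand for the triangles of the claw-free
  graph, vertices of degree 2 for its diamonds.
\<close>

definition port_system :: "'a set \<Rightarrow> ('a \<Rightarrow> 'a) \<Rightarrow> ('a \<Rightarrow> 'b) \<Rightarrow> bool" where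
  "port_system P \<pi> bl \<longleftrightarrow> finite P \<and>
     (\<forall>p \<in> P. \<pi> p \<in> P \<and> \<pi> (\<pi> p) = p \<and> \<pi> p \<noteq> p) \<and>
     (\<forall>p \<in> P. card (block P bl p) \<in> {2, 3}) \<and>
     (\<forall>X. card (cut P \<pi> bl X) \<noteq> 1)"

text \<open>
  These are the conditions under which a colouring of the external vertices extends to all triangles
  and diamonds such that no vertex has two neighbours of its own colour: an external edge may be
  monochromatic only if both its ends have no neighbour of their colour inside their unit. In a
  diamond this requires the two tips to have the same colour, so that the middle vertices can get
  the other one.
\<close>

definition locally_ok :: "'a set \<Rightarrow> ('a \<Rightarrow> 'a) \<Rightarrow> ('a \<Rightarrow> 'b) \<Rightarrow> ('a \<Rightarrow> bool) \<Rightarrow> 'a \<Rightarrow> bool" where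
  "locally_ok P \<pi> bl c p \<longleftrightarrow>
     (if card (block P bl p) = 3
      then (\<exists>q \<in> block P bl p. c q \<noteq> c p) \<and>
           (c (\<pi> p) = c p \<longrightarrow> (\<forall>q \<in> block P bl p - {p}. c q \<noteq> c p))
      else c (\<pi> p) = c p \<longrightarrow> (\<forall>q \<in> block P bl p. c q = c p))"

definition spin :: "bool \<Rightarrow> int" where
  "spin b = (if b then 1 else -1)"

text \<open>The spins of a triangle split 2 to 1 add up to its majority colour. Ports of diamonds
  are left out because a diamond is balanced by its middle vertices, which are not ports.\<close>

definition triangle_ports :: "'a set \<Rightarrow> ('a \<Rightarrow> 'b) \<Rightarrow> 'a set" where
  "triangle_ports P bl = {p \<in> P. card (block P bl p) = 3}"

definition admissible :: "'a set \<Rightarrow> ('a \<Rightarrow> 'a) \<Rightarrow> ('a \<Rightarrow> 'b) \<Rightarrow> ('a \<Rightarrow> bool) \<Rightarrow> bool" where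
  "admissible P \<pi> bl c \<longleftrightarrow> (\<forall>p \<in> P. locally_ok P \<pi> bl c p) \<and>
     (\<Sum>p \<in> triangle_ports P bl. spin (c p)) = 0"

text \<open>A union of whole vertices of the multigraph; deleting it leaves the degrees of the other
  vertices unchanged.\<close>

definition saturated :: "'a set \<Rightarrow> ('a \<Rightarrow> 'b) \<Rightarrow> 'a set \<Rightarrow> bool" where
  "saturated P bl Q \<longleftrightarrow> Q \<subseteq> P \<and> (\<forall>p \<in> Q. block P bl p \<subseteq> Q)"

section \<open>Deleting vertices from a port system and joining loose ends\<close>

lemma port_systemD:
  assumes "port_system P \<pi> bl"
  shows "finite P" "p \<in> P \<Longrightarrow> \<pi> p \<in> P" "p \<in> P \<Longrightarrow> \<pi> (\<pi> p) = p" "p \<in> P \<Longrightarrow> \<pi> p \<noteq> p"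
    "p \<in> P \<Longrightarrow> card (block P bl p) = 2 \<or> card (block P bl p) = 3"
    "card (cut P \<pi> bl X) \<noteq> 1"
  using assms unfolding port_system_def by auto

lemma block_Diff_saturated:
  assumes "saturated P bl Q" "p \<in> P - Q"
  shows "block (P - Q) bl p = block P bl p"
  using assms unfolding saturated_def block_def by fastforce

text \<open>Cuts are indexed by labels, not by ports; this allows \<open>Q\<close> to be moved to
  either side of a cut by adding or removing its labels.\<close>

lemma saturated_label:
  assumes "saturated P bl Q" "p \<in> P"
  shows "bl p \<in> bl ` Q \<longleftrightarrow> p \<in> Q"
  using assms unfolding saturated_def block_def by fastforce

lemma saturated_Un:
  assumes "saturated P bl Q" "saturated P bl R"
  shows "saturated P bl (Q \<union> R)"
  using assms unfolding saturated_def by blast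

lemma saturated_block: "saturated P bl (block P bl p)"
  unfolding saturated_def block_def by auto

text \<open>No edge joins \<open>Q\<close> to the rest, so the cut at \<open>X\<close> is an old
  cut, taken at \<open>X\<close> without the labels of \<open>Q\<close>.\<close>

lemma card_cut_Diff:
  assumes "port_system P \<pi> bl" "saturated P bl Q" "\<forall>p\<in>Q. \<pi> p \<in> Q"
  shows "card (cut (P - Q) \<pi> bl X) \<noteq> 1"
proof -
  have "p \<in> cut (P - Q) \<pi> bl X \<longleftrightarrow> p \<in> cut P \<pi> bl (X - bl ` Q)" for p
  proof (cases "p \<in> P")
    case True
    note D = port_systemD(2,3)[OF assms(1) True]
    have "\<pi> p \<in> Q \<longleftrightarrow> p \<in> Q" using assms(3) D(2) by metis
    then show ?thesis
      using True saturated_label[OF assms(2) True] saturated_label[OF assms(2) D(1)]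
      unfolding cut_def by blast
  qed (simp add: cut_def)
  then have "cut (P - Q) \<pi> bl X = cut P \<pi> bl (X - bl ` Q)" by blast
  then show ?thesis using port_systemD(6)[OF assms(1)] by simp
qed

lemma port_system_Diff_closed:
  assumes "port_system P \<pi> bl" "saturated P bl Q" "\<forall>p\<in>Q. \<pi> p \<in> Q"
  shows "port_system (P - Q) \<pi> bl"
proof -
  note D = port_systemD[OF assms(1)]
  have "\<pi> p \<in> P - Q" if "p \<in> P - Q" for p
    using that assms(3) D(2,3) by (metis DiffD1 DiffD2 DiffI)
  then show ?thesis unfolding port_system_def
    using D(1,3,4,5) block_Diff_saturated[OF assms(2)] card_cut_Diff[OF assms] by auto
qed

text \<open>Only two edges leave \<open>Q\<close>, so \<open>Q\<close> behaves like a subdivision of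
  the single edge \<open>x y\<close> that replaces it. This serves both a digon and two triangles
  joined by two parallel edges.\<close>

lemma port_system_Diff_joined:
  assumes ps: "port_system P \<pi> bl" and sat: "saturated P bl Q"
    and a: "a \<in> Q" "d \<in> Q" "a \<noteq> d" "\<pi> a = x" "\<pi> d = y" "x \<notin> Q" "y \<notin> Q"
    and cl: "\<forall>p\<in>Q - {a, d}. \<pi> p \<in> Q"
  shows "port_system (P - Q) (\<pi>(x := y, y := x)) bl"
proof -
  let ?\<pi> = "\<pi>(x := y, y := x)"
  note D = port_systemD[OF ps]
  have QP: "Q \<subseteq> P" using sat unfolding saturated_def by simp
  have xy: "x \<in> P" "y \<in> P" "\<pi> x = a" "\<pi> y = d" "x \<noteq> y"
  proof -
    have ad: "a \<in> P" "d \<in> P" using a QP by auto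
    show "x \<in> P" "y \<in> P" "\<pi> x = a" "\<pi> y = d" using D(2,3)[OF ad(1)] D(2,3)[OF ad(2)] a by auto
    then show "x \<noteq> y" using a by auto
  qed
  have out: "\<pi> p \<notin> Q" if "p \<in> P - Q" "p \<noteq> x" "p \<noteq> y" for p
  proof
    assume "\<pi> p \<in> Q"
    then show False using that cl D(3) a by (metis DiffD1 DiffD2 DiffI insertE singletonD)
  qed
  have inv: "?\<pi> p \<in> P - Q \<and> ?\<pi> (?\<pi> p) = p \<and> ?\<pi> p \<noteq> p" if "p \<in> P - Q" for p
  proof (cases "p = x \<or> p = y")
    case True
    then show ?thesis using xy a by auto
  next
    case False
    then have "\<pi> p \<in> P - Q" using out that D(2) by auto
    moreover have "\<pi> p \<noteq> x" "\<pi> p \<noteq> y" using xy a D(3) that by (metis DiffD1 DiffD2)+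
    ultimately show ?thesis using False that D(3,4) by auto
  qed
  have c: "card (cut (P - Q) ?\<pi> bl X) \<noteq> 1" for X
  proof -
    \<comment> \<open>\<open>Q\<close> is put inside exactly when both \<open>x\<close> and
      \<open>y\<close> are inside. Then the new edge crosses iff exactly one of the edges
      \<open>x a\<close> and \<open>y d\<close> does, and from the same port, so the two cuts are
      equal as sets.\<close>
    let ?Y = "if bl x \<in> X \<and> bl y \<in> X then X \<union> bl ` Q else X - bl ` Q"
    note L = saturated_label[OF sat]
    have "p \<in> cut (P - Q) ?\<pi> bl X \<longleftrightarrow> p \<in> cut P \<pi> bl ?Y" for p
    proof (cases "p \<in> P")
      case False
      then show ?thesis by (simp add: cut_def)
    next
      case True
      note Lp = L[OF True] and Lq = L[OF D(2)[OF True]]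
      consider "p = a \<or> p = d" | "p \<in> Q" "p \<noteq> a" "p \<noteq> d" | "p = x \<or> p = y"
        | "p \<notin> Q" "p \<noteq> x" "p \<noteq> y" by blast
      then show ?thesis
      proof cases
        case 1
        then show ?thesis using a Lp Lq by (auto simp: cut_def)
      next
        case 2
        then have "\<pi> p \<in> Q" using cl by auto
        then show ?thesis using 2 Lp Lq by (auto simp: cut_def)
      next
        case 3
        have "bl x \<notin> bl ` Q" "bl y \<notin> bl ` Q" "bl a \<in> bl ` Q" "bl d \<in> bl ` Q"
          using L xy a by auto
        then show ?thesis using 3 a xy by (auto simp: cut_def)
      next
        case 4
        then show ?thesis using Lp Lq out True by (auto simp: cut_def)
      qed
    qed
    then have "cut (P - Q) ?\<pi> bl X = cut P \<pi> bl ?Y" by blast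
    then show ?thesis using D(6) by metis
  qed
  show ?thesis unfolding port_system_def
    using D(1,5) inv c block_Diff_saturated[OF sat] by auto
qed

text \<open>A monochromatic partner only adds requirements to \<open>locally_ok\<close>. By
  \<open>edges\<close> every edge that is monochromatic now was so in the smaller system, hence the
  conditions outside \<open>Q\<close> are inherited, and \<open>Q\<close> has to be balanced on its
  own.\<close>

lemma admissible_extend:
  assumes ps: "port_system P \<pi> bl" and sat: "saturated P bl Q"
    and c': "admissible (P - Q) \<pi>' bl c'" and maps: "\<forall>p\<in>P - Q. \<pi>' p \<in> P - Q"
    and c: "\<forall>p\<in>P - Q. c p = c' p"
    and edges: "\<forall>p\<in>P - Q. c (\<pi> p) = c p \<longrightarrow> c (\<pi>' p) = c p"
    and Q: "\<forall>p\<in>Q. locally_ok P \<pi> bl c p"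
    and bal: "(\<Sum>p \<in> {p \<in> Q. card (block P bl p) = 3}. spin (c p)) = 0"
  shows "admissible P \<pi> bl c"
proof -
  have fin: "finite P" "Q \<subseteq> P" using port_systemD(1)[OF ps] sat by (auto simp: saturated_def)
  note B = block_Diff_saturated[OF sat]
  have "locally_ok P \<pi> bl c p" if "p \<in> P" for p
  proof (cases "p \<in> Q")
    case True
    then show ?thesis using Q by simp
  next
    case False
    then have p: "p \<in> P - Q" using that by simp
    define b where "b = block P bl p"
    have l: "locally_ok (P - Q) \<pi>' bl c' p" using c' p by (simp add: admissible_def)
    have cq: "c q = c' q" if "q \<in> b" for q
      using B[OF p] c that by (auto simp: block_def b_def)
    have cp: "c' p = c p" "c' (\<pi>' p) = c (\<pi>' p)" using p maps c by auto
    have e: "c (\<pi>' p) = c p" if "c (\<pi> p) = c p"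
      using p edges that by blast
    show ?thesis
      using l cq e unfolding locally_ok_def B[OF p] b_def[symmetric] cp
      by (cases "card b = 3") auto
  qed
  moreover have "(\<Sum>p \<in> triangle_ports P bl. spin (c p)) = 0"
  proof -
    have "triangle_ports P bl = triangle_ports (P - Q) bl \<union> {p \<in> Q. card (block P bl p) = 3}"
      using B fin by (auto simp: triangle_ports_def)
    moreover have "triangle_ports (P - Q) bl \<inter> {p \<in> Q. card (block P bl p) = 3} = {}"
      by (auto simp: triangle_ports_def)
    moreover have "(\<Sum>p \<in> triangle_ports (P - Q) bl. spin (c p)) = (\<Sum>p \<in> triangle_ports (P - Q) bl. spin (c' p))"
      using c by (intro sum.cong) (auto simp: triangle_ports_def)
    moreover have "finite (triangle_ports (P - Q) bl)" "finite {p \<in> Q. card (block P bl p) = 3}"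
      using fin by (auto simp: triangle_ports_def intro: finite_subset)
    ultimately show ?thesis using c' bal by (simp add: sum.union_disjoint admissible_def)
  qed
  ultimately show ?thesis by (simp add: admissible_def)
qed

section \<open>Local conditions at digons and triangles\<close>

lemma locally_ok_triangle:
  assumes "block P bl p = {p, q, r}" "p \<noteq> q" "p \<noteq> r" "q \<noteq> r"
    and "\<not> (c p = c q \<and> c p = c r)"
    and "c (\<pi> p) = c p \<longrightarrow> c q \<noteq> c p \<and> c r \<noteq> c p"
  shows "locally_ok P \<pi> bl c p"
  using assms unfolding locally_ok_def by auto

lemma block_eq:
  assumes "q \<in> block P bl p"
  shows "block P bl q = block P bl p"
  using assms unfolding block_def by auto

lemma block_self: "p \<in> P \<Longrightarrow> p \<in> block P bl p"
  unfolding block_def by simp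

lemma block_card2E:
  assumes "p \<in> P" "card (block P bl p) = 2"
  obtains q where "block P bl p = {p, q}" "p \<noteq> q"
proof -
  obtain a b where "block P bl p = {a, b}" "a \<noteq> b"
    using assms(2) card_2_iff by metis
  then show ?thesis using that[of a] that[of b] block_self[OF assms(1), of bl] by auto
qed

lemma block_card3E:
  assumes "p \<in> P" "card (block P bl p) = 3"
  obtains q r where "block P bl p = {p, q, r}" "distinct [p, q, r]"
proof -
  obtain a b c where abc: "block P bl p = {a, b, c}" "a \<noteq> b" "b \<noteq> c" "a \<noteq> c"
    using assms(2) card_3_iff by metis
  then consider "p = a" | "p = b" | "p = c" using block_self[OF assms(1), of bl] by auto
  then show ?thesis
  proof cases
    case 1 then show ?thesis using that[of b c] abc by auto
  next
    case 2 then show ?thesis using that[of a c] abc by auto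
  next
    case 3 then show ?thesis using that[of a b] abc by auto
  qed
qed

text \<open>A loop at a vertex of degree 3 would make its third edge a bridge.\<close>

lemma triangle_no_inner_edge:
  assumes ps: "port_system P \<pi> bl" and p: "p \<in> P"
    and blk: "block P bl p = {p, q, r}" "distinct [p, q, r]"
  shows "\<pi> p \<noteq> q"
proof
  assume pq: "\<pi> p = q"
  note D = port_systemD[OF ps]
  have P: "q \<in> P" "r \<in> P" and bl: "bl q = bl p" "bl r = bl p"
    using blk(1) unfolding block_def by auto
  have r: "\<pi> r \<notin> {p, q, r}" using D(3)[OF p] D(3)[OF P(1)] D(3,4)[OF P(2)] pq blk(2) by auto
  then have r': "bl (\<pi> r) \<noteq> bl p" using D(2)[OF P(2)] blk(1) unfolding block_def by blast
  have "s \<in> cut P \<pi> bl {bl p} \<longleftrightarrow> s = r" for s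
  proof
    assume "s \<in> cut P \<pi> bl {bl p}"
    then have "s \<in> block P bl p" "bl (\<pi> s) \<noteq> bl p" unfolding cut_def block_def by auto
    then show "s = r" using blk pq bl D(3)[OF p] by auto
  next
    assume "s = r"
    then show "s \<in> cut P \<pi> bl {bl p}" using r' P bl unfolding cut_def by auto
  qed
  then have "cut P \<pi> bl {bl p} = {r}" by blast
  then show False using D(6)[of "{bl p}"] by simp
qed

text \<open>\<open>locally_ok\<close> at three ports at once in purely propositional form, so that
  explicit colourings can be checked by cases on Booleans.\<close>

definition triangle_ok :: "('a \<Rightarrow> 'a) \<Rightarrow> ('a \<Rightarrow> bool) \<Rightarrow> 'a \<Rightarrow> 'a \<Rightarrow> 'a \<Rightarrow> bool" where
  "triangle_ok \<pi> c p q r \<longleftrightarrow> \<not> (c p = c q \<and> c p = c r) \<and>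
     (c (\<pi> p) = c p \<longrightarrow> c q \<noteq> c p \<and> c r \<noteq> c p) \<and>
     (c (\<pi> q) = c q \<longrightarrow> c p \<noteq> c q \<and> c r \<noteq> c q) \<and>
     (c (\<pi> r) = c r \<longrightarrow> c p \<noteq> c r \<and> c q \<noteq> c r)"

lemma locally_ok_triangle_block:
  assumes "block P bl p = {p, q, r}" "distinct [p, q, r]" "triangle_ok \<pi> c p q r" "s \<in> {p, q, r}"
  shows "locally_ok P \<pi> bl c s"
proof -
  have b: "block P bl s = {p, q, r}" using block_eq[of s P bl p] assms(1,4) by simp
  have "s = p \<or> s = q \<or> s = r" using assms(4) by blast
  note t = assms(3)[unfolded triangle_ok_def]
  have d: "p \<noteq> q" "p \<noteq> r" "q \<noteq> r" using assms(2) by auto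
  have "{p, q, r} = {q, p, r}" "{p, q, r} = {r, p, q}" by auto
  then show ?thesis
    using b t d \<open>s = p \<or> s = q \<or> s = r\<close> locally_ok_triangle[of P bl s] by metis
qed

lemma admissible_extend_triangles:
  assumes ps: "port_system P \<pi> bl"
    and u: "block P bl u0 = {u0, u1, u2}" and v: "block P bl v0 = {v0, v1, v2}"
    and dist: "distinct [u0, u1, u2, v0, v1, v2]" and Q: "Q = {u0, u1, u2, v0, v1, v2}"
    and c': "admissible (P - Q) \<pi>' bl c'" and maps: "\<forall>p\<in>P - Q. \<pi>' p \<in> P - Q"
    and c: "\<forall>p\<in>P - Q. c p = c' p"
    and edges: "\<forall>p\<in>P - Q. c (\<pi> p) = c p \<longrightarrow> c (\<pi>' p) = c p"
    and ok: "triangle_ok \<pi> c u0 u1 u2" "triangle_ok \<pi> c v0 v1 v2"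
    and bal: "spin (c u0) + spin (c u1) + spin (c u2) + spin (c v0) + spin (c v1) + spin (c v2) = 0"
  shows "admissible P \<pi> bl c"
proof (rule admissible_extend[OF ps _ c' maps c edges])
  have "Q = block P bl u0 \<union> block P bl v0" using Q u v by auto
  then show "saturated P bl Q" using saturated_Un saturated_block by metis
  show "\<forall>p\<in>Q. locally_ok P \<pi> bl c p"
    using locally_ok_triangle_block[OF u _ ok(1)] locally_ok_triangle_block[OF v _ ok(2)] dist Q
    by auto
  have "card (block P bl p) = 3" if "p \<in> Q" for p
  proof -
    have "p \<in> block P bl u0 \<or> p \<in> block P bl v0" using that Q u v by auto
    then have "block P bl p = {u0, u1, u2} \<or> block P bl p = {v0, v1, v2}"
      using u v block_eq by metis
    moreover have "card {u0, u1, u2} = 3" "card {v0, v1, v2} = 3" using dist by simp_all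
    ultimately show ?thesis by metis
  qed
  then have "{p \<in> Q. card (block P bl p) = 3} = Q" by auto
  moreover have "(\<Sum>p \<in> Q. spin (c p)) = spin (c u0) + spin (c u1) + spin (c u2)
      + spin (c v0) + spin (c v1) + spin (c v2)"
    unfolding Q using dist by simp
  ultimately show "(\<Sum>p \<in> {p \<in> Q. card (block P bl p) = 3}. spin (c p)) = 0"
    using bal by metis
qed

text \<open>The guard \<open>f \<in> P\<close> keeps the induction hypothesis applicable when
  \<open>f\<close> itself has been deleted.\<close>

definition colourable :: "'a set \<Rightarrow> ('a \<Rightarrow> 'a) \<Rightarrow> ('a \<Rightarrow> 'b) \<Rightarrow> 'a \<Rightarrow> bool" where
  "colourable P \<pi> bl f \<longleftrightarrow> (\<exists>c. admissible P \<pi> bl c \<and> (f \<in> P \<longrightarrow> c (\<pi> f) \<noteq> c f))"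

text \<open>Both ports of the digon get the colour opposite to their partner. All edges at the digon
  are then bichromatic for every colouring of the smaller system, including \<open>f\<close> if it
  is one of them.\<close>

lemma colourable_digon:
  assumes ps: "port_system P \<pi> bl" and a: "a \<in> P" "card (block P bl a) = 2"
    and IH: "\<And>P' \<pi>'. P' \<subset> P \<Longrightarrow> port_system P' \<pi>' bl \<Longrightarrow> colourable P' \<pi>' bl f"
  shows "colourable P \<pi> bl f"
proof -
  note D = port_systemD[OF ps]
  obtain d where d: "block P bl a = {a, d}" "a \<noteq> d" using block_card2E[OF a] .
  define Q where "Q = {a, d}"
  have dP: "d \<in> P" using d(1) unfolding block_def by blast
  have "block P bl d = {a, d}" using block_eq[of d P bl a] d by simp
  then have card2: "card (block P bl p) = 2" if "p \<in> Q" for p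
    using that d unfolding Q_def by auto
  have sat: "saturated P bl Q" using saturated_block[of P bl a] d by (simp add: Q_def)
  have sub: "P - Q \<subset> P" using a unfolding Q_def by auto
  have bal: "(\<Sum>p \<in> {p \<in> Q. card (block P bl p) = 3}. spin (c p)) = 0" for c
  proof -
    have "{p \<in> Q. card (block P bl p) = 3} = {}" using card2 by auto
    then show ?thesis by (simp only: sum.empty)
  qed
  have ok: "locally_ok P \<pi> bl c p" if "p \<in> Q" "c (\<pi> p) \<noteq> c p" for p c
    using that card2 unfolding locally_ok_def by simp
  show ?thesis
  proof (cases "\<pi> a = d")
    case True
    then have da: "\<pi> d = a" using D(3) a by auto
    have cl: "\<forall>p\<in>Q. \<pi> p \<in> Q" using True da unfolding Q_def by auto
    have ps': "port_system (P - Q) \<pi> bl" by (rule port_system_Diff_closed[OF ps sat cl])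
    obtain c' where c': "admissible (P - Q) \<pi> bl c'" "f \<in> P - Q \<longrightarrow> c' (\<pi> f) \<noteq> c' f"
      using IH[OF sub ps'] unfolding colourable_def by auto
    \<comment> \<open>The digon is a vertex with a loop and thus a component of its own, so any two
      different colours will do.\<close>
    define c where "c = c'(a := True, d := False)"
    have cc': "\<forall>p\<in>P - Q. c p = c' p" unfolding c_def Q_def by auto
    have bi: "\<forall>p\<in>Q. c (\<pi> p) \<noteq> c p" using True da d unfolding c_def Q_def by auto
    have maps: "\<forall>p\<in>P - Q. \<pi> p \<in> P - Q" using port_systemD(2)[OF ps'] by blast
    have "\<forall>p\<in>Q. locally_ok P \<pi> bl c p" using ok bi by blast
    then have "admissible P \<pi> bl c"
      by (rule admissible_extend[OF ps sat c'(1) maps cc' _ _ bal, rotated]) blast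
    moreover have "c (\<pi> f) \<noteq> c f" if "f \<in> P"
    proof (cases "f \<in> Q")
      case False
      then have f: "f \<in> P - Q" using that by simp
      then have "c f = c' f" "c (\<pi> f) = c' (\<pi> f)" using cc' maps by blast+
      then show ?thesis using c'(2) f by simp
    qed (use bi in blast)
    ultimately show ?thesis unfolding colourable_def by blast
  next
    case False
    define x y where "x = \<pi> a" and "y = \<pi> d"
    have y: "y \<noteq> a" using False D(3)[OF dP] y_def by auto
    have out: "x \<notin> Q" "y \<notin> Q" "x \<in> P" "y \<in> P" "\<pi> x = a" "\<pi> y = d"
      using D(2-4) a dP False y x_def y_def unfolding Q_def by auto
    then have xy: "x \<noteq> y" using d by auto
    define \<pi>' where "\<pi>' = \<pi>(x := y, y := x)"
    have ps': "port_system (P - Q) \<pi>' bl"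
      unfolding \<pi>'_def
      by (rule port_system_Diff_joined[OF ps sat, of a d]) (use d out x_def y_def Q_def in auto)
    obtain c' where c': "admissible (P - Q) \<pi>' bl c'" "f \<in> P - Q \<longrightarrow> c' (\<pi>' f) \<noteq> c' f"
      using IH[OF sub ps'] unfolding colourable_def by auto
    define c where "c = c'(a := \<not> c' x, d := \<not> c' y)"
    have cc': "\<forall>p\<in>P - Q. c p = c' p" unfolding c_def Q_def by auto
    have bi: "c (\<pi> p) \<noteq> c p" if p: "p \<in> Q \<union> {x, y}" for p
    proof -
      have cv: "c a = (\<not> c x)" "c d = (\<not> c y)" using out d unfolding c_def Q_def by auto
      consider "p = a" | "p = d" | "p = x" | "p = y" using p unfolding Q_def by blast
      then show ?thesis using cv out(5,6) x_def y_def by cases simp_all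
    qed
    have maps: "\<forall>p\<in>P - Q. \<pi>' p \<in> P - Q" using port_systemD(2)[OF ps'] by blast
    have lok: "\<forall>p\<in>Q. locally_ok P \<pi> bl c p" using ok bi by blast
    have "\<forall>p\<in>P - Q. c (\<pi> p) = c p \<longrightarrow> c (\<pi>' p) = c p"
    proof (intro ballI impI)
      fix p assume "p \<in> P - Q" "c (\<pi> p) = c p"
      then show "c (\<pi>' p) = c p" using bi[of p] by (cases "p \<in> {x, y}") (auto simp: \<pi>'_def)
    qed
    then have "admissible P \<pi> bl c"
      by (rule admissible_extend[OF ps sat c'(1) maps cc' _ lok bal])
    moreover have "c (\<pi> f) \<noteq> c f" if "f \<in> P"
    proof (cases "f \<in> Q \<union> {x, y}")
      case False
      then have f: "\<pi>' f = \<pi> f" "f \<in> P - Q" using that unfolding \<pi>'_def by auto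
      then have "c f = c' f" "c (\<pi> f) = c' (\<pi> f)" using cc' maps by metis+
      then show ?thesis using c'(2) f by simp
    qed (use bi in blast)
    ultimately show ?thesis unfolding colourable_def by blast
  qed
qed

section \<open>Two triangles joined by several edges\<close>

lemma block_card3_otherE:
  assumes "p \<in> P" "q \<in> P" "bl p = bl q" "p \<noteq> q" "card (block P bl p) = 3"
  obtains r where "block P bl p = {p, q, r}" "distinct [p, q, r]"
proof -
  obtain a b where ab: "block P bl p = {p, a, b}" "distinct [p, a, b]"
    using block_card3E[OF assms(1,5)] .
  moreover have "q \<in> block P bl p" using assms(2,3) unfolding block_def by simp
  ultimately consider "q = a" | "q = b" using assms(4) by auto
  then show ?thesis
  proof cases
    case 1 then show ?thesis using that[of b] ab by auto
  next
    case 2 then show ?thesis using that[of a] ab by auto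
  qed
qed

lemma triangle_partner_label:
  assumes ps: "port_system P \<pi> bl" and p: "p \<in> P" "card (block P bl p) = 3"
  shows "bl (\<pi> p) \<noteq> bl p"
proof
  assume "bl (\<pi> p) = bl p"
  then have m: "\<pi> p \<in> block P bl p" using port_systemD(2)[OF ps p(1)] unfolding block_def by simp
  obtain q r where qr: "block P bl p = {p, q, r}" "distinct [p, q, r]"
    using block_card3E[OF p] .
  then have rq: "block P bl p = {p, r, q}" "distinct [p, r, q]" by auto
  show False
    using m qr(1) triangle_no_inner_edge[OF ps p(1) qr] triangle_no_inner_edge[OF ps p(1) rq]
      port_systemD(4)[OF ps p(1)] by simp
qed

lemma triangle_okI_bichromatic:
  assumes "\<not> (c p = c q \<and> c p = c r)"
    and "c (\<pi> p) \<noteq> c p" "c (\<pi> q) \<noteq> c q" "c (\<pi> r) \<noteq> c r"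
  shows "triangle_ok \<pi> c p q r"
  using assms unfolding triangle_ok_def by blast

text \<open>The second triangle is coloured opposite to the first, which balances the pair and makes
  the parallel edges bichromatic. As all edges at the first triangle become bichromatic, it does not
  matter which of them is \<open>f\<close>.\<close>

lemma colourable_parallel:
  assumes ps: "port_system P \<pi> bl" and tri: "\<forall>p\<in>P. card (block P bl p) = 3"
    and p: "p \<in> P" "q \<in> P" "bl p = bl q" "p \<noteq> q" "bl (\<pi> p) = bl (\<pi> q)"
    and f: "f \<in> block P bl p"
    and IH: "\<And>P' \<pi>' g. P' \<subset> P \<Longrightarrow> port_system P' \<pi>' bl \<Longrightarrow> colourable P' \<pi>' bl g"
  shows "colourable P \<pi> bl f"
proof -
  note D = port_systemD[OF ps]
  obtain r where u: "block P bl p = {p, q, r}" "distinct [p, q, r]"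
    using block_card3_otherE p tri by metis
  define p' q' where "p' = \<pi> p" and "q' = \<pi> q"
  have pq': "p' \<in> P" "q' \<in> P" "\<pi> p' = p" "\<pi> q' = q" "p' \<noteq> q'" "bl p' = bl q'"
    using D(2,3)[OF p(1)] D(2,3)[OF p(2)] p p'_def q'_def by auto
  obtain r' where v: "block P bl p' = {p', q', r'}" "distinct [p', q', r']"
    using block_card3_otherE[OF pq'(1,2,6,5)] tri pq'(1) by metis
  have r: "r \<in> P" "bl r = bl p" and r': "r' \<in> P" "bl r' = bl p'"
    using u(1) v(1) unfolding block_def by blast+
  have bl: "bl p' \<noteq> bl p"
    using triangle_partner_label[OF ps p(1)] tri p(1) p'_def by blast
  have dist: "distinct [p, q, r, p', q', r']"
    using u(2) v(2) bl r r' p(3) pq'(6) by auto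
  define Q where "Q = {p, q, r, p', q', r'}"
  have "Q = block P bl p \<union> block P bl p'" using u v Q_def by auto
  then have sat: "saturated P bl Q" using saturated_Un saturated_block by metis
  have sub: "P - Q \<subset> P" using p unfolding Q_def by auto
  have fQ: "f \<in> Q" using f u Q_def by auto
  have colour: "colourable P \<pi> bl f"
    if c': "admissible (P - Q) \<pi>' bl c'" and maps: "\<forall>p\<in>P - Q. \<pi>' p \<in> P - Q"
      and edges: "\<And>c z. z \<in> P - Q \<Longrightarrow> \<forall>p\<in>P - Q. c p = c' p \<Longrightarrow> \<forall>p\<in>Q. c (\<pi> p) \<noteq> c p \<Longrightarrow>
        c (\<pi> z) = c z \<Longrightarrow> c (\<pi>' z) = c z"
      and bi: "\<And>c. \<forall>p\<in>P - Q. c p = c' p \<Longrightarrow> c r = (\<not> s) \<Longrightarrow> c r' = s \<Longrightarrow>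
        c (\<pi> r) \<noteq> c r \<and> c (\<pi> r') \<noteq> c r'"
    for \<pi>' c' s
  proof -
    \<comment> \<open>The parallel edges already split both triangles, so \<open>s\<close> remains
      free to fit the edges at \<open>r\<close> and \<open>r'\<close>.\<close>
    define c where "c = c'(p := s, q := \<not> s, r := \<not> s, p' := \<not> s, q' := s, r' := s)"
    have cc': "\<forall>p\<in>P - Q. c p = c' p" unfolding c_def Q_def by auto
    have cv: "c p = s" "c q = (\<not> s)" "c r = (\<not> s)" "c p' = (\<not> s)" "c q' = s" "c r' = s"
      using dist unfolding c_def by auto
    have bir: "c (\<pi> r) \<noteq> c r" "c (\<pi> r') \<noteq> c r'" using bi[OF cc' cv(3,6)] by auto
    have bip: "c (\<pi> p) \<noteq> c p" "c (\<pi> q) \<noteq> c q" "c (\<pi> p') \<noteq> c p'" "c (\<pi> q') \<noteq> c q'"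
      unfolding pq' p'_def[symmetric] q'_def[symmetric] cv by auto
    have all: "\<forall>p\<in>Q. c (\<pi> p) \<noteq> c p" unfolding Q_def using bip bir by blast
    have "triangle_ok \<pi> c p q r" "triangle_ok \<pi> c p' q' r'"
      using triangle_okI_bichromatic bip bir cv by metis+
    moreover have "spin (c p) + spin (c q) + spin (c r) + spin (c p') + spin (c q') + spin (c r') = 0"
      unfolding cv spin_def by simp
    moreover have "\<forall>p\<in>P - Q. c (\<pi> p) = c p \<longrightarrow> c (\<pi>' p) = c p"
      using edges[OF _ cc' all] by blast
    ultimately have "admissible P \<pi> bl c"
      using admissible_extend_triangles[OF ps u(1) v(1) dist Q_def c' maps cc'] by blast
    then show ?thesis using all fQ unfolding colourable_def by blast
  qed
  show ?thesis
  proof (cases "\<pi> r = r'")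
    case True
    then have "\<pi> r' = r" using D(3)[OF r(1)] by simp
    then have cl: "\<forall>p\<in>Q. \<pi> p \<in> Q" using True pq' p'_def q'_def unfolding Q_def by auto
    have ps': "port_system (P - Q) \<pi> bl" by (rule port_system_Diff_closed[OF ps sat cl])
    obtain c' where c': "admissible (P - Q) \<pi> bl c'"
      using IH[OF sub ps'] unfolding colourable_def by auto
    have maps: "\<forall>p\<in>P - Q. \<pi> p \<in> P - Q" using port_systemD(2)[OF ps'] by blast
    show ?thesis by (rule colour[OF c' maps, where s = True]) (simp_all add: True \<open>\<pi> r' = r\<close>)
  next
    case False
    define x y where "x = \<pi> r" and "y = \<pi> r'"
    have xr: "\<pi> x = r" "\<pi> y = r'" "x \<in> P" "y \<in> P" using D(2,3) r r' x_def y_def by auto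
    have "\<pi> r \<noteq> p" "\<pi> r \<noteq> q" "\<pi> r \<noteq> p'" "\<pi> r \<noteq> q'"
      using D(3)[OF r(1)] pq' p'_def q'_def dist by auto
    then have x: "x \<notin> Q" using False D(4)[OF r(1)] x_def unfolding Q_def by auto
    have "\<pi> r' \<noteq> p" "\<pi> r' \<noteq> q" "\<pi> r' \<noteq> p'" "\<pi> r' \<noteq> q'" "\<pi> r' \<noteq> r"
      using D(3)[OF r'(1)] pq' p'_def q'_def dist False by auto
    then have y: "y \<notin> Q" using D(4)[OF r'(1)] y_def unfolding Q_def by auto
    have xy: "x \<noteq> y" using xr dist by auto
    define \<pi>' where "\<pi>' = \<pi>(x := y, y := x)"
    have ps': "port_system (P - Q) \<pi>' bl"
      unfolding \<pi>'_def
      by (rule port_system_Diff_joined[OF ps sat, of r r'])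
        (use dist x y x_def y_def Q_def pq' p'_def q'_def in auto)
    \<comment> \<open>\<open>r\<close> and \<open>r'\<close> get different colours, so their outer
      partners \<open>x\<close> and \<open>y\<close> must differ as well; hence \<open>x y\<close>
      is the edge to prescribe.\<close>
    obtain c' where c': "admissible (P - Q) \<pi>' bl c'" "c' (\<pi>' x) \<noteq> c' x"
      using IH[OF sub ps'] x xr unfolding colourable_def by blast
    have maps: "\<forall>p\<in>P - Q. \<pi>' p \<in> P - Q" using port_systemD(2)[OF ps'] by blast
    have cy: "c' y \<noteq> c' x" using c'(2) xy unfolding \<pi>'_def by simp
    show ?thesis
    proof (rule colour[OF c'(1) maps, where s = "c' x"])
      fix c assume "\<forall>p\<in>P - Q. c p = c' p" "c r = (\<not> c' x)" "c r' = c' x"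
      then show "c (\<pi> r) \<noteq> c r \<and> c (\<pi> r') \<noteq> c r'"
        using cy x y xr(3,4) unfolding x_def[symmetric] y_def[symmetric] by simp
    next
      fix c z assume z: "z \<in> P - Q" "c (\<pi> z) = c z" and all: "\<forall>p\<in>Q. c (\<pi> p) \<noteq> c p"
      have "c x \<noteq> c r" "c y \<noteq> c r'" using all unfolding Q_def x_def y_def by blast+
      then have "z \<noteq> x" "z \<noteq> y" using xr z by auto
      then show "c (\<pi>' z) = c z" using z unfolding \<pi>'_def by simp
    qed
  qed
qed

section \<open>Frink reductions\<close>

lemma card_filter_eq_sum: "finite F \<Longrightarrow> card {p \<in> F. \<phi> p} = (\<Sum>p\<in>F. of_bool (\<phi> p))"
  by (simp add: sum.If_cases of_bool_def Int_def)

text \<open>\<open>u0 v0\<close> is the edge to be deleted. By \<open>out\<close> it is the only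
  edge within the two triangles, so exactly four edges leave them, with outer ends
  \<open>x1\<close>, \<open>x2\<close>, \<open>y1\<close>, \<open>y2\<close>.\<close>

locale triangle_edge =
  fixes P :: "'a set" and \<pi> :: "'a \<Rightarrow> 'a" and bl :: "'a \<Rightarrow> 'b" and u0 u1 u2 v0 v1 v2 :: 'a
  assumes ps: "port_system P \<pi> bl"
    and u: "block P bl u0 = {u0, u1, u2}" and v: "block P bl v0 = {v0, v1, v2}"
    and dist: "distinct [u0, u1, u2, v0, v1, v2]"
    and uv: "\<pi> u0 = v0"
    and out: "\<pi> u1 \<notin> {u0, u1, u2, v0, v1, v2}" "\<pi> u2 \<notin> {u0, u1, u2, v0, v1, v2}"
      "\<pi> v1 \<notin> {u0, u1, u2, v0, v1, v2}" "\<pi> v2 \<notin> {u0, u1, u2, v0, v1, v2}"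
begin

abbreviation "Q \<equiv> {u0, u1, u2, v0, v1, v2}"
abbreviation "x1 \<equiv> \<pi> u1"
abbreviation "x2 \<equiv> \<pi> u2"
abbreviation "y1 \<equiv> \<pi> v1"
abbreviation "y2 \<equiv> \<pi> v2"
abbreviation "R \<equiv> P - Q - {x1, x2, y1, y2}"
abbreviation "\<pi>' \<equiv> \<pi>(x1 := y1, y1 := x1, x2 := y2, y2 := x2)"

text \<open>Exchanging \<open>v1\<close> and \<open>v2\<close> turns one pairing of the loose ends
  into the other, so everything proved about \<open>\<pi>'\<close> holds for both.\<close>

lemma swap: "triangle_edge P \<pi> bl u0 u1 u2 v0 v2 v1"
proof -
  have "{u0, u1, u2, v0, v2, v1} = Q" "{v0, v2, v1} = {v0, v1, v2}" by auto
  then show ?thesis using ps u v dist uv out by unfold_locales auto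
qed

lemmas system = port_systemD[OF ps]

lemma QP: "u0 \<in> P" "u1 \<in> P" "u2 \<in> P" "v0 \<in> P" "v1 \<in> P" "v2 \<in> P"
  using u v unfolding block_def by auto

lemma xP: "x1 \<in> P" "x2 \<in> P" "y1 \<in> P" "y2 \<in> P"
  using system(2) QP by auto

lemma \<pi>x: "\<pi> x1 = u1" "\<pi> x2 = u2" "\<pi> y1 = v1" "\<pi> y2 = v2" "\<pi> v0 = u0"
  using system(3) QP uv by auto

lemma x_distinct: "distinct [x1, x2, y1, y2]"
  using \<pi>x dist by (metis distinct_length_2_or_more distinct_singleton)

lemma sat: "saturated P bl Q"
proof -
  have "Q = block P bl u0 \<union> block P bl v0" using u v by auto
  then show ?thesis using saturated_Un saturated_block by metis
qed

lemma \<pi>R: "p \<in> R \<Longrightarrow> \<pi> p \<in> R"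
proof -
  assume p: "p \<in> R"
  then have "\<pi> p \<in> P" "\<pi> (\<pi> p) = p" using system(2,3) by auto
  moreover have "\<pi> p \<noteq> q" if "q \<in> Q" for q
  proof
    assume "\<pi> p = q"
    then have "p = \<pi> q" using system(3) p by auto
    then show False using that p uv \<pi>x by auto
  qed
  moreover have "\<pi> p \<noteq> q" if "q \<in> {x1, x2, y1, y2}" for q
  proof
    assume "\<pi> p = q"
    then have "p = \<pi> q" using system(3) p by auto
    then have "p \<in> Q" using that \<pi>x by auto
    then show False using p by auto
  qed
  ultimately show "\<pi> p \<in> R" by blast
qed

lemma P_decomp: "P = R \<union> {x1, x2, y1, y2} \<union> Q" "P - Q = R \<union> {x1, x2, y1, y2}"
  using QP xP out by auto

text \<open>The contribution of the edges untouched by the reduction, common to the cuts of the old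
  system and of both reduced ones.\<close>

definition inner_cut :: "'b set \<Rightarrow> nat" where
  "inner_cut X = (\<Sum>p\<in>R. of_bool (bl p \<in> X \<and> bl (\<pi> p) \<notin> X))"

lemma finR: "finite R"
  using system(1) by simp

lemma label: "p \<in> P \<Longrightarrow> bl p \<in> bl ` Q \<longleftrightarrow> p \<in> Q"
  using saturated_label[OF sat] .

lemma label_R: "p \<in> R \<Longrightarrow> bl p \<notin> bl ` Q"
  using label by auto

lemma label_x: "bl x1 \<notin> bl ` Q" "bl x2 \<notin> bl ` Q" "bl y1 \<notin> bl ` Q" "bl y2 \<notin> bl ` Q"
  using label[OF xP(1)] label[OF xP(2)] label[OF xP(3)] label[OF xP(4)] out by auto

lemma cut_sum: "card (cut P \<pi> bl X) = (\<Sum>p\<in>R. of_bool (bl p \<in> X \<and> bl (\<pi> p) \<notin> X)) +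
  (\<Sum>p\<in>{x1, x2, y1, y2}. of_bool (bl p \<in> X \<and> bl (\<pi> p) \<notin> X)) +
  (\<Sum>p\<in>Q. of_bool (bl p \<in> X \<and> bl (\<pi> p) \<notin> X))"
proof -
  have "card (cut P \<pi> bl X) = (\<Sum>p\<in>P. of_bool (bl p \<in> X \<and> bl (\<pi> p) \<notin> X))"
    unfolding cut_def by (rule card_filter_eq_sum[OF system(1)])
  also have "\<dots> = (\<Sum>p\<in>R \<union> {x1, x2, y1, y2} \<union> Q. of_bool (bl p \<in> X \<and> bl (\<pi> p) \<notin> X))"
    using P_decomp(1) by simp
  also have "\<dots> = (\<Sum>p\<in>R \<union> {x1, x2, y1, y2}. of_bool (bl p \<in> X \<and> bl (\<pi> p) \<notin> X)) +
     (\<Sum>p\<in>Q. of_bool (bl p \<in> X \<and> bl (\<pi> p) \<notin> X))"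
    by (rule sum.union_disjoint) (use finR out in auto)
  also have "(\<Sum>p\<in>R \<union> {x1, x2, y1, y2}. of_bool (bl p \<in> X \<and> bl (\<pi> p) \<notin> X)) =
     (\<Sum>p\<in>R. of_bool (bl p \<in> X \<and> bl (\<pi> p) \<notin> X)) +
     ((\<Sum>p\<in>{x1, x2, y1, y2}. of_bool (bl p \<in> X \<and> bl (\<pi> p) \<notin> X)) :: nat)"
    by (rule sum.union_disjoint) (use finR in auto)
  finally show ?thesis .
qed

lemma inner_cut_cong: "(\<And>p. p \<in> R \<Longrightarrow> bl p \<in> X \<longleftrightarrow> bl p \<in> Y) \<Longrightarrow> inner_cut X = inner_cut Y"
  unfolding inner_cut_def using \<pi>R by (intro sum.cong) auto

lemma sum_x: "(\<Sum>p\<in>{x1, x2, y1, y2}. f p) = f x1 + f x2 + f y1 + (f y2 :: nat)"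
  using x_distinct by simp

lemma sum_Q: "(\<Sum>p\<in>Q. f p) = f u0 + f u1 + f u2 + f v0 + f v1 + (f v2 :: nat)"
  using dist by simp

text \<open>The old system has no bridge at the cut with both triangles outside; a loose edge then
  crosses iff its outer end is in \<open>X\<close>.\<close>

lemma inner_cut_inside: "inner_cut X + of_bool (bl x1 \<in> X) + of_bool (bl x2 \<in> X) + of_bool (bl y1 \<in> X) +
  of_bool (bl y2 \<in> X) \<noteq> 1"
proof -
  let ?X = "X - bl ` Q"
  have "inner_cut X = inner_cut ?X" using label_R by (intro inner_cut_cong) blast
  moreover have "card (cut P \<pi> bl ?X) = inner_cut ?X + of_bool (bl x1 \<in> X) + of_bool (bl x2 \<in> X) +
    of_bool (bl y1 \<in> X) + of_bool (bl y2 \<in> X)"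
    unfolding cut_sum sum_x sum_Q inner_cut_def \<pi>x using label_x by simp
  ultimately show ?thesis using system(6) by metis
qed

text \<open>The same with both triangles moved inside the cut.\<close>

lemma inner_cut_outside: "inner_cut X + of_bool (bl x1 \<notin> X) + of_bool (bl x2 \<notin> X) + of_bool (bl y1 \<notin> X) +
  of_bool (bl y2 \<notin> X) \<noteq> 1"
proof -
  let ?X = "X \<union> bl ` Q"
  have "inner_cut X = inner_cut ?X" using label_R by (intro inner_cut_cong) blast
  moreover have "card (cut P \<pi> bl ?X) = inner_cut ?X + of_bool (bl x1 \<notin> X) + of_bool (bl x2 \<notin> X) +
    of_bool (bl y1 \<notin> X) + of_bool (bl y2 \<notin> X)"
    unfolding cut_sum sum_x sum_Q inner_cut_def \<pi>x uv using label_x by simp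
  ultimately show ?thesis using system(6) by metis
qed

lemma \<pi>'x: "\<pi>' x1 = y1" "\<pi>' x2 = y2" "\<pi>' y1 = x1" "\<pi>' y2 = x2"
  using x_distinct by (auto simp: eq_commute)

lemma card_cut_reduced: "card (cut (P - Q) \<pi>' bl X) =
  inner_cut X + of_bool ((bl x1 \<in> X) \<noteq> (bl y1 \<in> X)) + of_bool ((bl x2 \<in> X) \<noteq> (bl y2 \<in> X))"
proof -
  have "card (cut (P - Q) \<pi>' bl X) = (\<Sum>p\<in>P - Q. of_bool (bl p \<in> X \<and> bl (\<pi>' p) \<notin> X))"
    unfolding cut_def by (rule card_filter_eq_sum) (use system(1) in simp)
  also have "\<dots> = (\<Sum>p\<in>R \<union> {x1, x2, y1, y2}. of_bool (bl p \<in> X \<and> bl (\<pi>' p) \<notin> X))"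
    using P_decomp(2) by simp
  also have "\<dots> = (\<Sum>p\<in>R. of_bool (bl p \<in> X \<and> bl (\<pi>' p) \<notin> X)) +
     (\<Sum>p\<in>{x1, x2, y1, y2}. of_bool (bl p \<in> X \<and> bl (\<pi>' p) \<notin> X))"
    by (rule sum.union_disjoint) (use finR in auto)
  also have "(\<Sum>p\<in>R. of_bool (bl p \<in> X \<and> bl (\<pi>' p) \<notin> X)) = inner_cut X"
    unfolding inner_cut_def by (intro sum.cong) auto
  also have "(\<Sum>p\<in>{x1, x2, y1, y2}. of_bool (bl p \<in> X \<and> bl (\<pi>' p) \<notin> X)) =
    (of_bool ((bl x1 \<in> X) \<noteq> (bl y1 \<in> X)) + of_bool ((bl x2 \<in> X) \<noteq> (bl y2 \<in> X)) :: nat)"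
    unfolding sum_x \<pi>'x by (simp add: of_bool_def)
  finally show ?thesis by (simp only: add.assoc)
qed

text \<open>If the single crossing edge were a new one, the ends of the other new edge would lie on
  one side, and placing both triangles on that side would give an old cut of size 1. So it is an
  inner edge. If all four loose ends were on one side, placing the triangles there would again leave
  only that edge.\<close>

lemma bridge_split:
  assumes "card (cut (P - Q) \<pi>' bl X) = 1"
  shows "inner_cut X = 1" "bl x1 \<in> X \<longleftrightarrow> bl y1 \<in> X" "bl x2 \<in> X \<longleftrightarrow> bl y2 \<in> X"
    "bl x1 \<in> X \<longleftrightarrow> bl x2 \<notin> X"
  using assms inner_cut_inside[of X] inner_cut_outside[of X] unfolding card_cut_reduced
  by (auto simp: of_bool_def split: if_splits)

lemma port_system_reduced:
  assumes "\<And>X. card (cut (P - Q) \<pi>' bl X) \<noteq> 1"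
  shows "port_system (P - Q) \<pi>' bl"
proof -
  have "\<pi>' p \<in> P - Q \<and> \<pi>' (\<pi>' p) = p \<and> \<pi>' p \<noteq> p" if "p \<in> P - Q" for p
  proof (cases "p \<in> R")
    case True
    then show ?thesis using \<pi>R[OF True] system(3,4) by auto
  next
    case False
    then have "p = x1 \<or> p = x2 \<or> p = y1 \<or> p = y2" using that by blast
    then show ?thesis using x_distinct xP out by (elim disjE) (simp_all only: \<pi>'x, auto)
  qed
  then show ?thesis
    unfolding port_system_def using system(1,5) assms block_Diff_saturated[OF sat] by auto
qed

end

text \<open>
  This is Frink's reduction of a bridgeless cubic graph. If both ways of joining the four loose ends
  create bridges, given by the sets \<open>X\<close> and \<open>Y\<close>, then each of the four cells of the partition generated
  by \<open>X\<close> and \<open>Y\<close> contains exactly one loose end and so is left by at least one more edge, but \<open>X\<close>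
  and \<open>Y\<close> are left by only one edge each.
\<close>

lemma (in triangle_edge) reduction:
  "port_system (P - Q) \<pi>' bl \<or>
   port_system (P - Q) (\<pi>(x1 := y2, y2 := x1, x2 := y1, y1 := x2)) bl"
proof (rule ccontr)
  assume neg: "\<not> ?thesis"
  interpret s: triangle_edge P \<pi> bl u0 u1 u2 v0 v2 v1 by (rule swap)
  have Qs: "{u0, u1, u2, v0, v2, v1} = Q" by auto
  have Rs: "s.inner_cut = inner_cut" unfolding s.inner_cut_def inner_cut_def Qs by (simp add: insert_commute)
  obtain X where X: "card (cut (P - Q) \<pi>' bl X) = 1"
    using neg port_system_reduced by blast
  obtain Y where Y: "card (cut (P - Q) (\<pi>(x1 := y2, y2 := x1, x2 := y1, y1 := x2)) bl Y) = 1"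
    using neg s.port_system_reduced unfolding Qs by blast
  note sX = bridge_split[OF X] and sY = s.bridge_split[unfolded Qs Rs, OF Y]
  \<comment> \<open>Inner edges between two cells, counted from the \<open>S\<close> side;
    \<open>\<pi>\<close> exchanges the two ends, hence the symmetry below.\<close>
  define e where "e S T = (\<Sum>p\<in>R. of_bool (bl p \<in> S \<and> bl (\<pi> p) \<in> T) :: nat)" for S T
  have e_sym: "e S T = e T S" for S T
    unfolding e_def
    by (rule sum.reindex_bij_witness[of _ \<pi> \<pi>]) (use \<pi>R system(3) in \<open>auto simp: conj_commute\<close>)
  define A B C E where "A = X \<inter> Y" and "B = X - Y" and "C = Y - X" and "E = - (X \<union> Y)"
  note defs = A_def B_def C_def E_def
  have pos: "inner_cut A \<ge> 1" "inner_cut B \<ge> 1" "inner_cut C \<ge> 1" "inner_cut E \<ge> 1"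
    using inner_cut_inside[of A] inner_cut_inside[of B] inner_cut_inside[of C] inner_cut_inside[of E] sX sY
    unfolding defs by (auto simp: of_bool_def split: if_splits)
  have "inner_cut X = e A C + e A E + e B C + e B E" "inner_cut Y = e A B + e A E + e C B + e C E"
    "inner_cut A = e A B + e A C + e A E" "inner_cut B = e B A + e B C + e B E"
    "inner_cut C = e C A + e C B + e C E" "inner_cut E = e E A + e E B + e E C"
    unfolding inner_cut_def e_def sum.distrib[symmetric]
    by (intro sum.cong refl; auto simp: defs)+
  note eqs = this sX(1) sY(1) pos e_sym[of B A] e_sym[of C A] e_sym[of E A] e_sym[of C B]
    e_sym[of E B] e_sym[of E C]
  \<comment> \<open>The four cell cuts count every edge between cells twice, so there are at least
    two such edges. Edges from \<open>A\<close> to \<open>E\<close> or from \<open>B\<close> to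
    \<open>C\<close> cross both \<open>X\<close> and \<open>Y\<close>, and these have only two
    crossings in total.\<close>
  have "e A E = 0" "e B C = 0" using eqs by linarith+
  \<comment> \<open>Only one edge crosses \<open>X\<close>. If it is not between \<open>A\<close>
    and \<open>C\<close>, both of these cells need an edge crossing \<open>Y\<close>; otherwise
    \<open>B\<close> and \<open>E\<close> do. But \<open>Y\<close> is crossed once.\<close>
  moreover have "e A C = 0 \<or> e B E = 0" using eqs by linarith
  ultimately show False using eqs by linarith
qed

text \<open>
  The edge \<open>x2 y2\<close> has to be bichromatic for the extension to exist: if both new edges were
  monochromatic with the same colour, both removed triangles would get the same majority colour.
  This is why \<open>colourable\<close> asks for a prescribed bichromatic edge.
\<close>

lemma (in triangle_edge) colourable_reduced:
  assumes ps': "port_system (P - Q) \<pi>' bl" and c': "colourable (P - Q) \<pi>' bl x2"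
  shows "colourable P \<pi> bl u2"
proof -
  have mem: "x1 \<in> P - Q" "x2 \<in> P - Q" "y1 \<in> P - Q" "y2 \<in> P - Q" using xP out by auto
  obtain c' where adm: "admissible (P - Q) \<pi>' bl c'" and "c' (\<pi>' x2) \<noteq> c' x2"
    using c' mem unfolding colourable_def by blast
  then have cy2: "c' y2 = (\<not> c' x2)" using x_distinct by auto
  have maps: "\<forall>p\<in>P - Q. \<pi>' p \<in> P - Q" using port_systemD(2)[OF ps'] by blast
  define S X Y where "S = c' x2" and "X = c' x1" and "Y = c' y1"
  \<comment> \<open>In both cases the \<open>v\<close> colours are the opposites of the
    \<open>u\<close> colours, which gives balance and makes \<open>u0 v0\<close> bichromatic. If
    \<open>X\<close> and \<open>Y\<close> differ, every edge at the triangles is bichromatic. If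
    they agree, one of the edges at \<open>u1\<close> and \<open>v1\<close> is monochromatic, so
    \<open>u1\<close> and \<open>v1\<close> are made the minority ports.\<close>
  define c where "c = c'(u0 := (if X = Y then \<not> S else S), u1 := (if X = Y then S else \<not> X),
    u2 := \<not> S, v0 := (if X = Y then S else \<not> S), v1 := (if X = Y then \<not> S else \<not> Y), v2 := S)"
  have cc': "\<forall>p\<in>P - Q. c p = c' p" unfolding c_def by auto
  have cv: "c u0 = (if X = Y then \<not> S else S)" "c u1 = (if X = Y then S else \<not> X)" "c u2 = (\<not> S)"
    "c v0 = (if X = Y then S else \<not> S)" "c v1 = (if X = Y then \<not> S else \<not> Y)" "c v2 = S"
    using dist unfolding c_def by auto
  have cx: "c x1 = X" "c x2 = S" "c y1 = Y" "c y2 = (\<not> S)"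
    using cc' mem cy2 unfolding S_def X_def Y_def by blast+
  have ok: "triangle_ok \<pi> c u0 u1 u2" "triangle_ok \<pi> c v0 v1 v2"
    unfolding triangle_ok_def uv \<pi>x cv cx by (cases S; cases X; cases Y; simp)+
  have bal: "spin (c u0) + spin (c u1) + spin (c u2) + spin (c v0) + spin (c v1) + spin (c v2) = 0"
    unfolding cv spin_def by (cases S; cases X; cases Y; simp)
  \<comment> \<open>Among the edges at the removed triangles only those at \<open>x1\<close> and
    \<open>y1\<close> can be monochromatic, and only if the new edge \<open>x1 y1\<close>
    was.\<close>
  have "\<forall>p\<in>P - Q. c (\<pi> p) = c p \<longrightarrow> c (\<pi>' p) = c p"
  proof (intro ballI impI)
    fix p assume p: "p \<in> P - Q" "c (\<pi> p) = c p"
    consider "p \<in> R" | "p = x1" | "p = y1" | "p = x2" | "p = y2" using p by blast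
    then show "c (\<pi>' p) = c p"
    proof cases
      case 1
      then have "\<pi>' p = \<pi> p" by simp
      then show ?thesis using p by simp
    next
      case 2
      then have "c u1 = c x1" using p(2) \<pi>x(1) by metis
      then have "X = Y" using cv(2) cx(1) by metis
      then show ?thesis using 2 cx \<pi>'x(1) by metis
    next
      case 3
      then have "c v1 = c y1" using p(2) \<pi>x(3) by metis
      then have "X = Y" using cv(5) cx(3) by metis
      then show ?thesis using 3 cx \<pi>'x(3) by metis
    next
      case 4
      then show ?thesis using p(2) cv(3) cx(2) \<pi>x(2) by metis
    next
      case 5
      then show ?thesis using p(2) cv(6) cx(4) \<pi>x(4) by metis
    qed
  qed
  then have "admissible P \<pi> bl c"
    using admissible_extend_triangles[OF ps u v dist refl adm maps cc' _ ok bal] by blast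
  moreover have "c (\<pi> u2) \<noteq> c u2" using cv cx by simp
  ultimately show ?thesis unfolding colourable_def by blast
qed

text \<open>Unless two edges lead from the triangle of \<open>f\<close> to the same triangle, its
  three neighbours are distinct, and the edge at another port \<open>p\<close> of this triangle can
  be deleted.\<close>

lemma colourable_triangles:
  assumes ps: "port_system P \<pi> bl" and tri: "\<forall>p\<in>P. card (block P bl p) = 3" and f: "f \<in> P"
    and IH: "\<And>P' \<pi>' g. P' \<subset> P \<Longrightarrow> port_system P' \<pi>' bl \<Longrightarrow> colourable P' \<pi>' bl g"
  shows "colourable P \<pi> bl f"
proof -
  note D = port_systemD[OF ps]
  obtain p q where fpq: "block P bl f = {f, p, q}" "distinct [f, p, q]"
    using block_card3E f tri by metis
  have pq: "p \<in> P" "q \<in> P" "bl p = bl f" "bl q = bl f" using fpq unfolding block_def by blast+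
  have u: "block P bl p = {p, q, f}" using block_eq[of p P bl f] fpq by auto
  show ?thesis
  proof (cases "\<exists>a b. a \<in> {f, p, q} \<and> b \<in> {f, p, q} \<and> a \<noteq> b \<and> bl (\<pi> a) = bl (\<pi> b)")
    case True
    then obtain a b where ab: "a \<in> block P bl f" "b \<in> block P bl f" "a \<noteq> b" "bl (\<pi> a) = bl (\<pi> b)"
      using fpq by blast
    then have "a \<in> P" "b \<in> P" "bl a = bl b" "f \<in> block P bl a" using f unfolding block_def by auto
    then show ?thesis using colourable_parallel[OF ps tri _ _ _ ab(3,4) _ IH] by blast
  next
    case False
    define v0 where "v0 = \<pi> p"
    have v0: "v0 \<in> P" "\<pi> v0 = p" using D(2,3) pq v0_def by auto
    obtain v1 v2 where v: "block P bl v0 = {v0, v1, v2}" "distinct [v0, v1, v2]"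
      using block_card3E v0 tri by metis
    have vP: "v1 \<in> P" "v2 \<in> P" "bl v1 = bl v0" "bl v2 = bl v0" using v unfolding block_def by blast+
    have inner: "bl (\<pi> a) \<noteq> bl a" if "a \<in> P" for a
      using triangle_partner_label[OF ps that] tri that by blast
    have bl: "bl v0 \<noteq> bl p" using inner[OF pq(1)] v0_def by simp
    have dist: "distinct [p, q, f, v0, v1, v2]"
      using fpq(2) v(2) bl vP pq by auto
    have ne: "bl (\<pi> q) \<noteq> bl v0" "bl (\<pi> f) \<noteq> bl v0" using False fpq(2) unfolding v0_def by auto
    have ne': "\<pi> a \<noteq> b" if "a \<in> {v1, v2}" "b \<in> {p, q, f}" for a b
    proof
      assume "\<pi> a = b"
      then have "a = \<pi> b" using that vP D(3) by auto
      then show False using that ne vP dist v0_def by auto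
    qed
    \<comment> \<open>\<open>f\<close> takes the place of \<open>u2\<close>, the port whose edge
      \<open>colourable_reduced\<close> makes bichromatic; \<open>swap\<close> leaves it
      there.\<close>
    interpret triangle_edge P \<pi> bl p q f v0 v1 v2
    proof
      show "\<pi> q \<notin> {p, q, f, v0, v1, v2}" "\<pi> f \<notin> {p, q, f, v0, v1, v2}"
        using ne inner[OF pq(2)] inner[OF f] vP pq by auto
      show "\<pi> v1 \<notin> {p, q, f, v0, v1, v2}" "\<pi> v2 \<notin> {p, q, f, v0, v1, v2}"
        using ne'[of v1] ne'[of v2] inner[OF vP(1)] inner[OF vP(2)] vP by auto
    qed (use ps u v dist v0_def in auto)
    have sub: "P - Q \<subset> P" using f by auto
    from reduction show ?thesis
    proof
      assume "port_system (P - Q) \<pi>' bl"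
      then show ?thesis using colourable_reduced IH[OF sub] by blast
    next
      interpret s: triangle_edge P \<pi> bl p q f v0 v2 v1 by (rule swap)
      have Qs: "{p, q, f, v0, v2, v1} = Q" by auto
      assume "port_system (P - Q) (\<pi>(x1 := y2, y2 := x1, x2 := y1, y1 := x2)) bl"
      then show ?thesis using s.colourable_reduced[unfolded Qs] IH[OF sub] by blast
    qed
  qed
qed

theorem port_system_colourable:
  assumes "port_system P \<pi> bl"
  shows "colourable P \<pi> bl f"
  using port_systemD(1)[OF assms] assms
proof (induction P arbitrary: \<pi> f rule: finite_psubset_induct)
  case (psubset P \<pi> f)
  note D = port_systemD[OF psubset.prems]
  have tri: "colourable P \<pi> bl f" if "f \<in> P" for f
  proof (cases "\<exists>a\<in>P. card (block P bl a) = 2")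
    case True
    then show ?thesis using colourable_digon[OF psubset.prems] psubset.IH by blast
  next
    case False
    then have "\<forall>a\<in>P. card (block P bl a) = 3" using D(5) by blast
    then show ?thesis using colourable_triangles[OF psubset.prems _ that] psubset.IH by blast
  qed
  show ?case
  proof (cases "P = {}")
    case True
    then show ?thesis unfolding colourable_def admissible_def triangle_ports_def by simp
  next
    case False
    \<comment> \<open>For \<open>f\<close> outside \<open>P\<close> any admissible colouring will
      do, so an arbitrary port is prescribed instead.\<close>
    then obtain g where "g \<in> P" by blast
    then obtain c where "admissible P \<pi> bl c" using tri unfolding colourable_def by blast
    then have "colourable P \<pi> bl f" if "f \<notin> P" using that unfolding colourable_def by blast
    then show ?thesis using tri by blast
  qed
qed

section \<open>Units of a claw-free cubic graph\<close>

lemma locally_okD_triangle: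
  assumes "locally_ok P \<pi> bl c p" "block P bl p = S" "card S = 3"
  shows "\<exists>q\<in>S. c q \<noteq> c p" "c (\<pi> p) = c p \<Longrightarrow> q \<in> S \<Longrightarrow> q \<noteq> p \<Longrightarrow> c q \<noteq> c p"
  using assms(1) unfolding locally_ok_def assms(2) if_P[OF assms(3)] by blast+

lemma locally_okD_digon:
  assumes "locally_ok P \<pi> bl c p" "block P bl p = S" "card S \<noteq> 3" "c (\<pi> p) = c p" "q \<in> S"
  shows "c q = c p"
  using assms(1,4,5) unfolding locally_ok_def assms(2) if_not_P[OF assms(3)] by blast

text \<open>Bridgelessness is stated for cuts, the form that carries over to ports. That the absence
  of bridges implies it is shown by \<open>bridge_of_singleton_cut\<close>.\<close>

locale claw_free_cubic =
  fixes V :: "'a set" and E :: "'a rel"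
  assumes finite_V: "finite V"
    and E_subset: "E \<subseteq> V \<times> V"
    and E_sym: "(v, w) \<in> E \<Longrightarrow> (w, v) \<in> E"
    and E_irrefl: "(v, v) \<notin> E"
    and degree: "v \<in> V \<Longrightarrow> card (E `` {v}) = 3"
    and claw_free: "\<lbrakk>(v, x) \<in> E; (v, y) \<in> E; (v, z) \<in> E; distinct [x, y, z]\<rbrakk> \<Longrightarrow>
      (x, y) \<in> E \<or> (y, z) \<in> E \<or> (x, z) \<in> E"
    and bridgeless: "card {e \<in> E. fst e \<in> S \<and> snd e \<notin> S} \<noteq> 1"
begin

abbreviation adj :: "'a \<Rightarrow> 'a \<Rightarrow> bool" (infix "\<sim>" 50) where
  "v \<sim> w \<equiv> (v, w) \<in> E"

section \<open>Triangles, diamonds and tetrahedra\<close>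

lemma adj_in_V: "v \<sim> w \<Longrightarrow> v \<in> V \<and> w \<in> V"
  using E_subset by auto

lemma adj_neq: "v \<sim> w \<Longrightarrow> v \<noteq> w"
  using E_irrefl by auto

lemma neighbours_eq:
  assumes "v \<sim> x" "v \<sim> y" "v \<sim> z" "x \<noteq> y" "x \<noteq> z" "y \<noteq> z"
  shows "v \<sim> w \<longleftrightarrow> w = x \<or> w = y \<or> w = z"
proof -
  have "card (E `` {v}) = 3" using degree adj_in_V assms(1) by blast
  moreover have "{x, y, z} \<subseteq> E `` {v}" "card {x, y, z} = 3" using assms by auto
  ultimately have "{x, y, z} = E `` {v}" by (metis card_subset_eq card.infinite zero_neq_numeral)
  then show ?thesis by blast
qed

lemma neighboursE:
  assumes "v \<in> V"
  obtains x y z where "v \<sim> x" "v \<sim> y" "v \<sim> z" "x \<noteq> y" "x \<noteq> z" "y \<noteq> z" "x \<sim> y"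
proof -
  obtain a b c where "E `` {v} = {a, b, c}" and d: "a \<noteq> b" "b \<noteq> c" "a \<noteq> c"
    using degree[OF assms] card_3_iff by metis
  then have n: "v \<sim> a" "v \<sim> b" "v \<sim> c" by blast+
  then consider "a \<sim> b" | "b \<sim> c" | "a \<sim> c" using claw_free d by fastforce
  then show ?thesis using that n d by cases metis+
qed

definition internal :: "'a \<Rightarrow> 'a \<Rightarrow> bool" where
  "internal v w \<longleftrightarrow> v \<sim> w \<and> (\<exists>z. v \<sim> z \<and> w \<sim> z)"

definition external :: "'a \<Rightarrow> 'a \<Rightarrow> bool" where
  "external v w \<longleftrightarrow> v \<sim> w \<and> (\<nexists>z. v \<sim> z \<and> w \<sim> z)"

text \<open>
  A unit is a connected component of the graph of internal edges, that is, a triangle, a diamond or a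
  tetrahedron. All of these have radius at most 2, so two internal steps suffice.
\<close>

definition unit :: "'a \<Rightarrow> 'a set" where
  "unit v = {w. \<exists>x. (v = x \<or> internal v x) \<and> (x = w \<or> internal x w)}"

definition ports :: "'a set" where
  "ports = {v. \<exists>w. external v w}"

definition partner :: "'a \<Rightarrow> 'a" where
  "partner v = (SOME w. external v w)"

text \<open>The last clause excludes the triangles contained in a diamond or a tetrahedron.\<close>

definition triangle :: "'a \<Rightarrow> 'a \<Rightarrow> 'a \<Rightarrow> bool" where
  "triangle a b c \<longleftrightarrow> a \<sim> b \<and> a \<sim> c \<and> b \<sim> c \<and>
     (\<forall>w. w \<notin> {a, b, c} \<longrightarrow> \<not> (w \<sim> a \<and> w \<sim> b) \<and> \<not> (w \<sim> a \<and> w \<sim> c) \<and> \<not> (w \<sim> b \<and> w \<sim> c))"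

text \<open>The tips are \<open>a\<close> and \<open>d\<close>; the middle vertices \<open>b\<close>
  and \<open>c\<close> have all their neighbours inside.\<close>

definition diamond :: "'a \<Rightarrow> 'a \<Rightarrow> 'a \<Rightarrow> 'a \<Rightarrow> bool" where
  "diamond a b c d \<longleftrightarrow> a \<sim> b \<and> a \<sim> c \<and> b \<sim> c \<and> b \<sim> d \<and> c \<sim> d \<and> a \<noteq> d \<and> \<not> a \<sim> d"

definition tetrahedron :: "'a \<Rightarrow> 'a \<Rightarrow> 'a \<Rightarrow> 'a \<Rightarrow> bool" where
  "tetrahedron a b c d \<longleftrightarrow> a \<sim> b \<and> a \<sim> c \<and> a \<sim> d \<and> b \<sim> c \<and> b \<sim> d \<and> c \<sim> d"

lemma unit_cases:
  assumes "v \<in> V"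
  obtains a b c where "triangle a b c" "v \<in> {a, b, c}"
    | a b c d where "diamond a b c d" "v \<in> {a, b, c, d}"
    | a b c d where "tetrahedron a b c d" "v \<in> {a, b, c, d}"
proof -
  note result = that
  \<comment> \<open>A further vertex \<open>w\<close> adjacent to two vertices of a triangle yields
    a tetrahedron or a diamond, according to whether it is adjacent to the third.\<close>
  have *: thesis if abc: "a \<sim> b" "a \<sim> c" "b \<sim> c" "v \<in> {a, b, c}" and w: "w \<sim> a" "w \<sim> b" "w \<noteq> c"
    for a b c w
  proof (cases "w \<sim> c")
    case True
    then have "tetrahedron a b c w" using abc w E_sym unfolding tetrahedron_def by blast
    then show thesis using result(3)[of a b c w] abc by blast
  next
    case False
    then have "diamond c a b w" using abc w E_sym unfolding diamond_def by blast
    then show thesis using result(2)[of c a b w] abc by blast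
  qed
  obtain x y z where n: "v \<sim> x" "v \<sim> y" "v \<sim> z" "x \<sim> y" using neighboursE[OF assms] by metis
  show thesis
  proof (cases "triangle v x y")
    case True
    then show thesis using result(1)[of v x y] by blast
  next
    case False
    then obtain w where "w \<notin> {v, x, y}" "w \<sim> v \<and> w \<sim> x \<or> w \<sim> v \<and> w \<sim> y \<or> w \<sim> x \<and> w \<sim> y"
      using n unfolding triangle_def by blast
    then show thesis using *[of v x y w] *[of v y x w] *[of x y v w] n E_sym by blast
  qed
qed

lemma external_sym: "external v w \<Longrightarrow> external w v"
  unfolding external_def using E_sym by blast

text \<open>Two of the three neighbours of \<open>v\<close> are adjacent, so the edges to them are
  internal and only one edge is left.\<close>

lemma external_unique: "external v w \<Longrightarrow> external v w' \<Longrightarrow> w = w'"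
proof -
  assume e: "external v w" "external v w'"
  then have "v \<in> V" using adj_in_V external_def by blast
  then obtain x y z where n: "v \<sim> x" "v \<sim> y" "v \<sim> z" "x \<noteq> y" "x \<noteq> z" "y \<noteq> z" "x \<sim> y"
    using neighboursE by metis
  then have "\<not> external v x" "\<not> external v y" using E_sym unfolding external_def by blast+
  then show "w = w'" using e neighbours_eq[OF n(1-6)] unfolding external_def by metis
qed

lemma adj_cases: "v \<sim> w \<Longrightarrow> internal v w \<or> external v w"
  unfolding internal_def external_def by blast

lemma partner: "v \<in> ports \<Longrightarrow> external v (partner v)"
  unfolding ports_def partner_def by (auto intro: someI)

lemma partner_eq: "external v w \<Longrightarrow> partner v = w"
  using external_unique partner ports_def by blast

lemma triangle_facts:
  assumes "triangle a b c"
  shows "triangle b a c" "triangle c a b"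
    "a \<noteq> b" "a \<noteq> c" "b \<noteq> c" "a \<in> V" "a \<in> ports" "internal a w \<longleftrightarrow> w = b \<or> w = c"
proof -
  note t = assms[unfolded triangle_def]
  show "triangle b a c" "triangle c a b" using t E_sym unfolding triangle_def by blast+
  show ne: "a \<noteq> b" "a \<noteq> c" "b \<noteq> c" using t adj_neq by blast+
  show V: "a \<in> V" using t adj_in_V by blast
  have "\<exists>z. a \<sim> z \<and> z \<noteq> b \<and> z \<noteq> c" using neighboursE[OF V] by metis
  then obtain z where z: "a \<sim> z" "z \<noteq> b" "z \<noteq> c" by blast
  then have n: "a \<sim> w \<longleftrightarrow> w = b \<or> w = c \<or> w = z" for w using neighbours_eq t ne by metis
  have "z \<noteq> a" using z adj_neq by blast
  then have "\<not> z \<sim> b" "\<not> z \<sim> c" using t z E_sym by blast+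
  then have e: "external a z" using z n adj_neq unfolding external_def by metis
  then show "a \<in> ports" unfolding ports_def by blast
  have "\<not> internal a z" using e unfolding internal_def external_def by blast
  moreover have "internal a b" "internal a c" using t E_sym unfolding internal_def by blast+
  ultimately show "internal a w \<longleftrightarrow> w = b \<or> w = c"
    using n unfolding internal_def by metis
qed

lemma diamond_facts:
  assumes "diamond a b c d"
  shows "diamond d b c a" "diamond a c b d"
    "a \<noteq> b" "a \<noteq> c" "a \<noteq> d" "b \<noteq> c" "b \<noteq> d" "c \<noteq> d" "a \<in> V" "b \<in> V" "a \<in> ports" "b \<notin> ports"
    "internal a w \<longleftrightarrow> w = b \<or> w = c" "internal b w \<longleftrightarrow> w = a \<or> w = c \<or> w = d"
proof -
  note t = assms[unfolded diamond_def]
  show "diamond d b c a" "diamond a c b d" using t E_sym unfolding diamond_def by blast+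
  show ne: "a \<noteq> b" "a \<noteq> c" "a \<noteq> d" "b \<noteq> c" "b \<noteq> d" "c \<noteq> d" using t adj_neq by blast+
  show V: "a \<in> V" "b \<in> V" using t adj_in_V by blast+
  have s: "b \<sim> a" "c \<sim> a" "c \<sim> b" "d \<sim> b" "d \<sim> c" using t E_sym by blast+
  have nb: "b \<sim> w \<longleftrightarrow> w = a \<or> w = c \<or> w = d" for w
    using neighbours_eq[of b a c d] t s ne by blast
  have nc: "c \<sim> w \<longleftrightarrow> w = a \<or> w = b \<or> w = d" for w
    using neighbours_eq[of c a b d] t s ne by blast
  have "\<exists>z. a \<sim> z \<and> z \<noteq> b \<and> z \<noteq> c" using neighboursE[OF V(1)] by metis
  then obtain z where z: "a \<sim> z" "z \<noteq> b" "z \<noteq> c" by blast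
  then have n: "a \<sim> w \<longleftrightarrow> w = b \<or> w = c \<or> w = z" for w using neighbours_eq t ne by metis
  have "z \<noteq> a" "z \<noteq> d" using z adj_neq t by blast+
  then have "\<not> b \<sim> z" "\<not> c \<sim> z" using z nb nc by auto
  then have e: "external a z" using z n adj_neq E_sym unfolding external_def by metis
  then show "a \<in> ports" unfolding ports_def by blast
  have "\<not> internal a z" using e unfolding internal_def external_def by blast
  moreover have "internal a b" "internal a c" using t E_sym unfolding internal_def by blast+
  ultimately show "internal a w \<longleftrightarrow> w = b \<or> w = c"
    using n unfolding internal_def by metis
  have i: "internal b a" "internal b c" "internal b d" using t s unfolding internal_def by blast+
  then show "internal b w \<longleftrightarrow> w = a \<or> w = c \<or> w = d"
    using nb unfolding internal_def by metis
  have "\<not> external b w" for w using i nb unfolding internal_def external_def by metis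
  then show "b \<notin> ports" unfolding ports_def by blast
qed

lemma tetrahedron_facts:
  assumes "tetrahedron a b c d"
  shows "tetrahedron b a c d" "tetrahedron c a b d" "tetrahedron d a b c"
    "a \<noteq> b" "a \<noteq> c" "a \<noteq> d" "b \<noteq> c" "b \<noteq> d" "c \<noteq> d" "a \<in> V" "a \<notin> ports"
    "internal a w \<longleftrightarrow> w = b \<or> w = c \<or> w = d"
proof -
  note t = assms[unfolded tetrahedron_def]
  have s: "b \<sim> a" "c \<sim> a" "d \<sim> a" "c \<sim> b" "d \<sim> b" "d \<sim> c" using t E_sym by blast+
  show "tetrahedron b a c d" "tetrahedron c a b d" "tetrahedron d a b c"
    using t s unfolding tetrahedron_def by blast+
  show ne: "a \<noteq> b" "a \<noteq> c" "a \<noteq> d" "b \<noteq> c" "b \<noteq> d" "c \<noteq> d" using t adj_neq by blast+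
  show "a \<in> V" using t adj_in_V by blast
  have n: "a \<sim> w \<longleftrightarrow> w = b \<or> w = c \<or> w = d" for w
    using neighbours_eq[of a b c d] t ne by blast
  have i: "internal a b" "internal a c" "internal a d" using t s unfolding internal_def by blast+
  then show "internal a w \<longleftrightarrow> w = b \<or> w = c \<or> w = d"
    using n unfolding internal_def by metis
  have "\<not> external a w" for w using i n unfolding internal_def external_def by metis
  then show "a \<notin> ports" unfolding ports_def by blast
qed

section \<open>Units partition the graph and form a port system\<close>

lemma unit_triangle:
  assumes "triangle a b c" "v \<in> {a, b, c}"
  shows "unit v = {a, b, c}"
proof -
  have i: "internal a w \<longleftrightarrow> w = b \<or> w = c" "internal b w \<longleftrightarrow> w = a \<or> w = c"
    "internal c w \<longleftrightarrow> w = a \<or> w = b" for w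
    using triangle_facts(8)[OF assms(1)] triangle_facts(8)[OF triangle_facts(1)[OF assms(1)]]
      triangle_facts(8)[OF triangle_facts(2)[OF assms(1)]] by simp_all
  have "v = a \<or> v = b \<or> v = c" using assms(2) by blast
  then show ?thesis unfolding unit_def by (elim disjE) (auto simp: i)
qed

lemma unit_diamond:
  assumes "diamond a b c d" "v \<in> {a, b, c, d}"
  shows "unit v = {a, b, c, d}"
proof -
  have i: "internal a w \<longleftrightarrow> w = b \<or> w = c" "internal b w \<longleftrightarrow> w = a \<or> w = c \<or> w = d"
    "internal c w \<longleftrightarrow> w = a \<or> w = b \<or> w = d" "internal d w \<longleftrightarrow> w = b \<or> w = c" for w
    using diamond_facts(13,14)[OF assms(1)] diamond_facts(14)[OF diamond_facts(2)[OF assms(1)]]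
      diamond_facts(13)[OF diamond_facts(1)[OF assms(1)]] by simp_all
  have "v = a \<or> v = b \<or> v = c \<or> v = d" using assms(2) by blast
  then show ?thesis unfolding unit_def by (elim disjE) (auto simp: i)
qed

lemma unit_tetrahedron:
  assumes "tetrahedron a b c d" "v \<in> {a, b, c, d}"
  shows "unit v = {a, b, c, d}"
proof -
  have i: "internal a w \<longleftrightarrow> w = b \<or> w = c \<or> w = d" "internal b w \<longleftrightarrow> w = a \<or> w = c \<or> w = d"
    "internal c w \<longleftrightarrow> w = a \<or> w = b \<or> w = d" "internal d w \<longleftrightarrow> w = a \<or> w = b \<or> w = c" for w
    using tetrahedron_facts(12)[OF assms(1)] tetrahedron_facts(12)[OF tetrahedron_facts(1)[OF assms(1)]]
      tetrahedron_facts(12)[OF tetrahedron_facts(2)[OF assms(1)]]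
      tetrahedron_facts(12)[OF tetrahedron_facts(3)[OF assms(1)]] by simp_all
  have "v = a \<or> v = b \<or> v = c \<or> v = d" using assms(2) by blast
  then show ?thesis unfolding unit_def by (elim disjE) (auto simp: i)
qed

lemma unit_self: "v \<in> unit v"
  unfolding unit_def by blast

text \<open>Reachability in at most two steps is not transitive in general; here the three shapes of
  units make it an equivalence on \<open>V\<close>.\<close>

lemma unit_eq_iff:
  assumes "v \<in> V"
  shows "w \<in> unit v \<longleftrightarrow> unit w = unit v"
proof -
  have "\<exists>S. v \<in> S \<and> (\<forall>x\<in>S. unit x = S)"
    using assms
  proof (cases rule: unit_cases)
    case (1 a b c)
    show ?thesis by (rule exI[of _ "{a, b, c}"]) (intro conjI ballI 1(2) unit_triangle[OF 1(1)])
  next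
    case (2 a b c d)
    show ?thesis by (rule exI[of _ "{a, b, c, d}"]) (intro conjI ballI 2(2) unit_diamond[OF 2(1)])
  next
    case (3 a b c d)
    show ?thesis by (rule exI[of _ "{a, b, c, d}"]) (intro conjI ballI 3(2) unit_tetrahedron[OF 3(1)])
  qed
  then obtain S where S: "v \<in> S" "\<forall>x\<in>S. unit x = S" by blast
  have v: "unit v = S" by (rule bspec[OF S(2,1)])
  show ?thesis unfolding v
  proof
    show "w \<in> S \<Longrightarrow> unit w = S" by (rule bspec[OF S(2)])
    show "unit w = S \<Longrightarrow> w \<in> S" using unit_self[of w] by simp
  qed
qed

lemma internal_unit:
  assumes "internal v w"
  shows "unit w = unit v"
proof -
  have "w \<in> unit v" using assms unfolding unit_def by blast
  moreover have "v \<in> V" using assms adj_in_V unfolding internal_def by blast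
  ultimately show ?thesis using unit_eq_iff by simp
qed

lemma ports_V: "ports \<subseteq> V"
  unfolding ports_def external_def using adj_in_V by blast

lemma block_ports: "v \<in> V \<Longrightarrow> block ports unit v = unit v \<inter> ports"
  unfolding block_def using unit_eq_iff by blast

lemma block_triangle:
  assumes "triangle a b c" "v \<in> {a, b, c}"
  shows "block ports unit v = {a, b, c}"
proof -
  have "v \<in> V" "{a, b, c} \<subseteq> ports" using triangle_facts(6,7) triangle_facts(1,2)[OF assms(1)] assms by blast+
  then show ?thesis using block_ports unit_triangle[OF assms] by blast
qed

lemma block_diamond:
  assumes "diamond a b c d" "v \<in> {a, b, c, d}"
  shows "block ports unit v = {a, d}"
proof -
  have "v \<in> V" "a \<in> ports" "d \<in> ports" "b \<notin> ports" "c \<notin> ports"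
    using diamond_facts(9,10,11,12) diamond_facts(1,2)[OF assms(1)] assms by blast+
  then show ?thesis using block_ports unit_diamond[OF assms] by blast
qed

text \<open>Internal edges stay within a unit, so the edges leaving a union of units are external
  and correspond to the ports of a cut. Tetrahedra have no ports.\<close>

lemma port_system_units: "port_system ports partner unit"
  unfolding port_system_def
proof (intro conjI ballI allI)
  show "finite ports" using ports_V finite_V by (rule finite_subset)
  fix p assume p: "p \<in> ports"
  have e: "external p (partner p)" using partner p .
  then have e': "external (partner p) p" by (rule external_sym)
  then show "partner p \<in> ports" unfolding ports_def by blast
  show "partner (partner p) = p" using partner_eq e' by blast
  show "partner p \<noteq> p" using e adj_neq unfolding external_def by metis
  have "p \<in> V" using p ports_V by blast
  then show "card (block ports unit p) \<in> {2, 3}"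
  proof (cases rule: unit_cases)
    case (1 a b c)
    then show ?thesis using block_triangle[OF 1] triangle_facts(3-5)[OF 1(1)] by simp
  next
    case (2 a b c d)
    then show ?thesis using block_diamond[OF 2] diamond_facts(5)[OF 2(1)] by simp
  next
    case (3 a b c d)
    then have "p \<notin> ports" using tetrahedron_facts(11) tetrahedron_facts(1-3)[OF 3(1)] by blast
    then show ?thesis using p by blast
  qed
next
  fix X
  let ?S = "{v. unit v \<in> X}"
  have "bij_betw (\<lambda>p. (p, partner p)) (cut ports partner unit X) {e \<in> E. fst e \<in> ?S \<and> snd e \<notin> ?S}"
    unfolding bij_betw_def
  proof
    show "inj_on (\<lambda>p. (p, partner p)) (cut ports partner unit X)" by (auto intro: inj_onI)
    show "(\<lambda>p. (p, partner p)) ` cut ports partner unit X = {e \<in> E. fst e \<in> ?S \<and> snd e \<notin> ?S}"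
    proof (intro equalityI subsetI)
      fix e assume "e \<in> (\<lambda>p. (p, partner p)) ` cut ports partner unit X"
      then show "e \<in> {e \<in> E. fst e \<in> ?S \<and> snd e \<notin> ?S}"
        using partner unfolding cut_def external_def by auto
    next
      fix e assume e: "e \<in> {e \<in> E. fst e \<in> ?S \<and> snd e \<notin> ?S}"
      obtain v w where vw: "e = (v, w)" by fastforce
      then have x: "external v w" using e adj_cases[of v w] internal_unit[of v w] by auto
      then have "w = partner v" "v \<in> ports" using partner_eq unfolding ports_def by blast+
      then show "e \<in> (\<lambda>p. (p, partner p)) ` cut ports partner unit X"
        using e vw unfolding cut_def by auto
    qed
  qed
  then have "card (cut ports partner unit X) = card {e \<in> E. fst e \<in> ?S \<and> snd e \<notin> ?S}"
    by (rule bij_betw_same_card)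
  then show "card (cut ports partner unit X) \<noteq> 1"
    using bridgeless[of ?S] by (simp only:) simp
qed

text \<open>The contract under which colourings of single units can be glued: port colours are kept,
  the spin is that of the triangle ports, so zero for diamonds and tetrahedra, and each vertex has
  at most one neighbour of its colour in the unit, or none if its external edge is
  monochromatic.\<close>

definition fits :: "('a \<Rightarrow> bool) \<Rightarrow> 'a set \<Rightarrow> ('a \<Rightarrow> bool) \<Rightarrow> bool" where
  "fits c S g \<longleftrightarrow> (\<forall>p \<in> S \<inter> ports. g p = c p) \<and>
     (\<Sum>v\<in>S. spin (g v)) = (\<Sum>v\<in>S \<inter> triangle_ports ports unit. spin (c v)) \<and>
     (\<forall>v\<in>S. \<forall>w\<in>S. \<forall>w'\<in>S. v \<sim> w \<and> v \<sim> w' \<and> g w = g v \<and> g w' = g v \<longrightarrow> w = w') \<and>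
     (\<forall>v\<in>S \<inter> ports. c (partner v) = c v \<longrightarrow> (\<forall>w\<in>S. v \<sim> w \<longrightarrow> g w \<noteq> g v))"

lemma fitsI:
  assumes "\<And>p. \<lbrakk>p \<in> S; p \<in> ports\<rbrakk> \<Longrightarrow> g p = c p"
    and "(\<Sum>v\<in>S. spin (g v)) = (\<Sum>v\<in>S \<inter> triangle_ports ports unit. spin (c v))"
    and "\<And>v w w'. \<lbrakk>v \<in> S; w \<in> S; w' \<in> S; v \<sim> w; v \<sim> w'; g w = g v; g w' = g v\<rbrakk> \<Longrightarrow> w = w'"
    and "\<And>v w. \<lbrakk>v \<in> S; v \<in> ports; c (partner v) = c v; w \<in> S; v \<sim> w\<rbrakk> \<Longrightarrow> g w \<noteq> g v"
  shows "fits c S g"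
  unfolding fits_def using assms by blast

lemma fitsD:
  assumes "fits c S g"
  shows "\<lbrakk>p \<in> S; p \<in> ports\<rbrakk> \<Longrightarrow> g p = c p"
    and "(\<Sum>v\<in>S. spin (g v)) = (\<Sum>v\<in>S \<inter> triangle_ports ports unit. spin (c v))"
    and "\<lbrakk>v \<in> S; w \<in> S; w' \<in> S; v \<sim> w; v \<sim> w'; g w = g v; g w' = g v\<rbrakk> \<Longrightarrow> w = w'"
    and "\<lbrakk>v \<in> S; v \<in> ports; c (partner v) = c v; w \<in> S; v \<sim> w\<rbrakk> \<Longrightarrow> g w \<noteq> g v"
  using assms unfolding fits_def by blast+

lemma fits_triangle:
  assumes adm: "admissible ports partner unit c" and t: "triangle a b d"
  shows "fits c {a, b, d} c"
proof -
  note ne = triangle_facts(3-5)[OF t]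
  have card: "card {a, b, d} = 3" using ne by simp
  have pt: "{a, b, d} \<subseteq> ports" using triangle_facts(7) triangle_facts(1,2)[OF t] t by blast
  have tp: "{a, b, d} \<inter> triangle_ports ports unit = {a, b, d}"
    using card pt block_triangle[OF t] unfolding triangle_ports_def by auto
  have ok: "\<exists>q\<in>{a, b, d}. c q \<noteq> c p"
    "c (partner p) = c p \<Longrightarrow> q \<in> {a, b, d} \<Longrightarrow> q \<noteq> p \<Longrightarrow> c q \<noteq> c p" if "p \<in> {a, b, d}" for p q
  proof -
    have "locally_ok ports partner unit c p" using adm pt that unfolding admissible_def by blast
    note D = locally_okD_triangle[OF this block_triangle[OF t that] card]
    show "\<exists>q\<in>{a, b, d}. c q \<noteq> c p" by (rule D(1))
    show "c (partner p) = c p \<Longrightarrow> q \<in> {a, b, d} \<Longrightarrow> q \<noteq> p \<Longrightarrow> c q \<noteq> c p" by (rule D(2))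
  qed
  have uniq: "w = w'" if "v \<in> {a, b, d}" "w \<in> {a, b, d}" "w' \<in> {a, b, d}" "v \<sim> w" "v \<sim> w'"
    "c w = c v" "c w' = c v" for v w w'
  proof (rule ccontr)
    assume "w \<noteq> w'"
    \<comment> \<open>Two neighbours with the colour of \<open>v\<close> would make the whole
      triangle monochromatic.\<close>
    then have "{v, w, w'} = {a, b, d}" using that(1-3) adj_neq[OF that(4)] adj_neq[OF that(5)] ne by auto
    then have "\<exists>q\<in>{v, w, w'}. c q \<noteq> c v" using ok(1)[OF that(1)] by (rule ssubst)
    then show False using that(6,7) by blast
  qed
  have lone: "c w \<noteq> c v" if "v \<in> {a, b, d}" "c (partner v) = c v" "w \<in> {a, b, d}" "v \<sim> w" for v w
    using ok(2)[OF that(1,2,3)] adj_neq[OF that(4)] by blast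
  show ?thesis
  proof (rule fitsI)
    show "(\<Sum>v\<in>{a, b, d}. spin (c v)) = (\<Sum>v\<in>{a, b, d} \<inter> triangle_ports ports unit. spin (c v))"
      unfolding tp ..
  qed (rule refl | rule uniq; assumption | rule lone; assumption)+
qed

lemma fits_diamond:
  assumes adm: "admissible ports partner unit c" and t: "diamond a b d e"
  shows "\<exists>g. fits c {a, b, d, e} g"
proof -
  note ne = diamond_facts(3-8)[OF t]
  \<comment> \<open>The middle vertices are both opposite to the tips if these agree, and get one
    colour each if they differ. Either way the diamond is balanced.\<close>
  define g where "g = c(b := (if c a = c e then \<not> c a else True), d := (if c a = c e then \<not> c a else False))"
  have gv: "g a = c a" "g e = c e" "g b = (if c a = c e then \<not> c a else True)"
    "g d = (if c a = c e then \<not> c a else False)"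
    using ne unfolding g_def by auto
  have card2: "card {a, e} = 2" using ne by simp
  then have card: "card (block ports unit v) = 2" if "v \<in> {a, b, d, e}" for v
    using block_diamond[OF t that] by simp
  have pt: "{a, b, d, e} \<inter> ports = {a, e}"
    using diamond_facts(11,12) diamond_facts(1,2)[OF t] t by blast
  have tp: "{a, b, d, e} \<inter> triangle_ports ports unit = {}"
    using card unfolding triangle_ports_def by fastforce
  have bal: "(\<Sum>v\<in>{a, b, d, e}. spin (g v)) = 0"
    using ne gv unfolding spin_def by simp
  have ok: "c a = c e" if "p \<in> {a, e}" "c (partner p) = c p" for p
  proof -
    have p: "p \<in> ports" "p \<in> {a, b, d, e}" using that pt by blast+
    then have lok: "locally_ok ports partner unit c p" using adm unfolding admissible_def by blast
    have "c q = c p" if "q \<in> {a, e}" for q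
      by (rule locally_okD_digon[OF lok block_diamond[OF t p(2)] _ _ that])
        (use card2 \<open>c (partner p) = c p\<close> in simp_all)
    then have "c a = c p" "c e = c p" by blast+
    then show ?thesis by (rule trans[OF _ sym])
  qed
  have nae: "\<not> a \<sim> e" "\<not> e \<sim> a" using t E_sym unfolding diamond_def by blast+
  have uniq: "w = w'" if "v \<in> {a, b, d, e}" "w \<in> {a, b, d, e}" "w' \<in> {a, b, d, e}" "v \<sim> w" "v \<sim> w'"
    "g w = g v" "g w' = g v" for v w w'
  proof -
    from that(1) consider "v = a" | "v = b" | "v = d" | "v = e" by blast
    then show ?thesis
    proof cases
      case 1
      then have "w = b \<or> w = d" "w' = b \<or> w' = d" using that nae E_irrefl by blast+
      then show ?thesis using that(6,7) gv 1 by metis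
    next
      case 2
      then have "w = a \<or> w = d \<or> w = e" "w' = a \<or> w' = d \<or> w' = e" using that E_irrefl by blast+
      then show ?thesis using that(6,7) gv 2 by metis
    next
      case 3
      then have "w = a \<or> w = b \<or> w = e" "w' = a \<or> w' = b \<or> w' = e" using that E_irrefl by blast+
      then show ?thesis using that(6,7) gv 3 by metis
    next
      case 4
      then have "w = b \<or> w = d" "w' = b \<or> w' = d" using that nae E_irrefl by blast+
      then show ?thesis using that(6,7) gv 4 by metis
    qed
  qed
  have lone: "g w \<noteq> g v" if "v \<in> {a, e}" "c (partner v) = c v" "w \<in> {a, b, d, e}" "v \<sim> w" for v w
  proof -
    have "c a = c e" using ok that by blast
    moreover have "w = b \<or> w = d" using that nae E_irrefl by blast
    moreover have "v = a \<or> v = e" using that by blast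
    ultimately show ?thesis using gv by metis
  qed
  have "fits c {a, b, d, e} g"
  proof (rule fitsI)
    show "(\<Sum>v\<in>{a, b, d, e}. spin (g v)) =
        (\<Sum>v\<in>{a, b, d, e} \<inter> triangle_ports ports unit. spin (c v))"
      unfolding tp bal by simp
    have p: "p \<in> {a, e}" if "p \<in> {a, b, d, e}" "p \<in> ports" for p
      using pt that by blast
    show "g p = c p" if "p \<in> {a, b, d, e}" "p \<in> ports" for p
      using p[OF that] gv(1,2) by blast
    show "g w \<noteq> g v" if "v \<in> {a, b, d, e}" "v \<in> ports" "c (partner v) = c v"
      "w \<in> {a, b, d, e}" "v \<sim> w" for v w
      using lone[OF p[OF that(1,2)] that(3-5)] .
  qed (rule uniq; assumption)
  then show ?thesis by blast
qed

text \<open>Any split 2 to 2 works: each vertex has exactly one neighbour of its own colour.\<close>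

lemma fits_tetrahedron:
  assumes t: "tetrahedron a b d e"
  shows "fits c {a, b, d, e} (\<lambda>v. v = a \<or> v = b)"
proof -
  note ne = tetrahedron_facts(4-9)[OF t]
  have np: "{a, b, d, e} \<inter> ports = {}"
    using tetrahedron_facts(11) tetrahedron_facts(1-3)[OF t] t by blast
  then have tp: "{a, b, d, e} \<inter> triangle_ports ports unit = {}"
    unfolding triangle_ports_def by blast
  have bal: "(\<Sum>v\<in>{a, b, d, e}. spin (v = a \<or> v = b)) = 0"
    using ne unfolding spin_def by auto
  have uniq: "w = w'" if "v \<in> {a, b, d, e}" "w \<in> {a, b, d, e}" "w' \<in> {a, b, d, e}" "v \<sim> w" "v \<sim> w'"
    "(w = a \<or> w = b) = (v = a \<or> v = b)" "(w' = a \<or> w' = b) = (v = a \<or> v = b)" for v w w'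
    using that(1-3,6-) adj_neq[OF that(4)] adj_neq[OF that(5)] by auto
  show ?thesis
  proof (rule fitsI)
    show "(\<Sum>v\<in>{a, b, d, e}. spin (v = a \<or> v = b)) =
        (\<Sum>v\<in>{a, b, d, e} \<inter> triangle_ports ports unit. spin (c v))"
      unfolding tp bal by simp
  qed (use np in blast, (rule uniq; assumption), use np in blast)
qed

lemma unit_fits:
  assumes "admissible ports partner unit c" "v \<in> V"
  shows "\<exists>g. fits c (unit v) g"
  using assms(2)
proof (cases rule: unit_cases)
  case (1 a b d)
  then show ?thesis using fits_triangle[OF assms(1)] unit_triangle by metis
next
  case (2 a b d e)
  then show ?thesis using fits_diamond[OF assms(1)] unit_diamond by metis
next
  case (3 a b d e)
  then show ?thesis using fits_tetrahedron unit_tetrahedron by metis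
qed

lemma unit_subset: "v \<in> V \<Longrightarrow> unit v \<subseteq> V"
  unfolding unit_def internal_def using adj_in_V by blast

text \<open>At most one neighbour of its own colour per vertex is the local form of having
  monochromatic components of at most two vertices.\<close>

theorem balanced_colouring:
  "\<exists>c. (\<Sum>v\<in>V. spin (c v)) = 0 \<and>
     (\<forall>v w w'. v \<sim> w \<and> v \<sim> w' \<and> c w = c v \<and> c w' = c v \<longrightarrow> w = w')"
proof -
  obtain c where adm: "admissible ports partner unit c"
    using port_system_colourable[OF port_system_units] unfolding colourable_def by blast
  have "\<forall>S\<in>unit ` V. \<exists>g. fits c S g" using unit_fits[OF adm] by blast
  then obtain G where G: "\<forall>S\<in>unit ` V. fits c S (G S)" by metis
  \<comment> \<open>The colourings were chosen per unit and not per vertex, so all vertices of a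
    unit read the same one.\<close>
  define k where "k v = G (unit v) v" for v
  have kG: "k w = G (unit v) w" if "w \<in> unit v" "v \<in> V" for v w
    using that unit_eq_iff unfolding k_def by simp
  have Gv: "fits c (unit v) (G (unit v))" if "v \<in> V" for v using G that by simp
  have kc: "k p = c p" if "p \<in> ports" for p
    unfolding k_def using fitsD(1)[OF Gv unit_self that] ports_V that by blast
  have "(\<Sum>v\<in>V. spin (k v)) = (\<Sum>S\<in>unit ` V. \<Sum>v\<in>{v \<in> V. unit v = S}. spin (k v))"
    using finite_V by (simp add: sum.group)
  also have "\<dots> = (\<Sum>S\<in>unit ` V. \<Sum>v\<in>{v \<in> triangle_ports ports unit. unit v = S}. spin (c v))"
  proof (rule sum.cong[OF refl])
    fix S assume S: "S \<in> unit ` V"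
    then obtain u where u: "u \<in> V" "S = unit u" by blast
    have "{v \<in> V. unit v = S} = S" using u unit_eq_iff unit_subset by blast
    then have "(\<Sum>v\<in>{v \<in> V. unit v = S}. spin (k v)) = (\<Sum>v\<in>S. spin (G S v))"
      using kG u by (intro sum.cong) auto
    also have "\<dots> = (\<Sum>v\<in>S \<inter> triangle_ports ports unit. spin (c v))"
      using fitsD(2)[OF Gv[OF u(1)]] unfolding u(2) .
    also have "S \<inter> triangle_ports ports unit = {v \<in> triangle_ports ports unit. unit v = S}"
      using u unit_eq_iff by blast
    finally show "(\<Sum>v\<in>{v \<in> V. unit v = S}. spin (k v)) =
      (\<Sum>v\<in>{v \<in> triangle_ports ports unit. unit v = S}. spin (c v))" .
  qed
  also have "\<dots> = (\<Sum>v\<in>triangle_ports ports unit. spin (c v))"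
    using finite_V ports_V finite_subset[of "triangle_ports ports unit" V]
    by (intro sum.group) (auto simp: triangle_ports_def)
  also have "\<dots> = 0" using adm unfolding admissible_def by blast
  finally have bal: "(\<Sum>v\<in>V. spin (k v)) = 0" .
  \<comment> \<open>A monochromatic external edge uses up the only permitted neighbour, by the last
    clause of \<open>fits\<close>.\<close>
  have ext: "k w \<noteq> k v" if "external v x" "k x = k v" "internal v w" for v w x
  proof -
    have p: "v \<in> ports" "x \<in> ports" "partner v = x"
      using that external_sym partner_eq unfolding ports_def by blast+
    then have V: "v \<in> V" using ports_V by blast
    have w: "w \<in> unit v" using that(3) unfolding unit_def by blast
    have "c (partner v) = c v" using p that(2) kc by simp
    then have "G (unit v) w \<noteq> G (unit v) v"
      using fitsD(4)[OF Gv[OF V] unit_self p(1) _ w] that(3) unfolding internal_def by blast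
    then show ?thesis unfolding kG[OF w V] kG[OF unit_self V] .
  qed
  have "w = w'" if "v \<sim> w" "v \<sim> w'" "k w = k v" "k w' = k v" for v w w'
  proof (cases "internal v w \<and> internal v w'")
    case True
    have V: "v \<in> V" using adj_in_V that by blast
    have u: "v \<in> unit v" "w \<in> unit v" "w' \<in> unit v" using True unfolding unit_def by blast+
    then have "G (unit v) w = G (unit v) v" "G (unit v) w' = G (unit v) v"
      using that(3,4) unfolding kG[OF u(1) V] kG[OF u(2) V] kG[OF u(3) V] by blast+
    then show ?thesis by (rule fitsD(3)[OF Gv[OF V] u that(1,2)])
  next
    case False
    with adj_cases[OF that(1)] adj_cases[OF that(2)]
    consider "external v w" "external v w'" | "external v w" "internal v w'"
      | "internal v w" "external v w'" by blast
    then show ?thesis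
    proof cases
      case 1
      then show ?thesis by (rule external_unique)
    next
      case 2
      then show ?thesis using ext[OF 2(1) that(3) 2(2)] that(4) by blast
    next
      case 3
      then show ?thesis using ext[OF 3(2) that(4) 3(1)] that(3) by blast
    qed
  qed
  then show ?thesis using bal by blast
qed

end

section \<open>Components and bridges\<close>

lemma (in wf_digraph) strongly_connected_imp_connected:
  assumes "strongly_connected G"
  shows "connected G"
  using assms reachable_mk_symmetricI unfolding strongly_connected_def by (intro connectedI) auto

context sym_digraph
begin

text \<open>\<open>H\<close> may contain an arc without its reverse; the induced subgraph on its
  vertices is symmetric, and there connectedness is strong.\<close>

lemma strongly_connected_induced:
  assumes "subgraph H G" "connected H"
  shows "strongly_connected (G \<restriction> verts H)"
proof -
  have sub: "verts H \<subseteq> verts G" using assms(1) by auto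
  interpret I: wf_digraph "G \<restriction> verts H" by (rule wellformed_induce_subgraph)
  have "spanning H (G \<restriction> verts H)"
    using subgraph_induce_subgraphI2[OF assms(1)] by (simp add: spanning_def)
  then have "connected (G \<restriction> verts H)" using assms(2) by (rule I.connected_spanning_imp_connected)
  moreover have "symmetric (G \<restriction> verts H)"
    using sym_arcs induced_induce[OF sub] by (rule induced_graph_imp_symmetric)
  ultimately show ?thesis using I.symmetric_connected_imp_strongly_connected by blast
qed

text \<open>Adding arcs preserves connectedness, so a maximal connected subgraph is induced and
  hence strongly connected. Conversely, a connected subgraph containing a strong component induces a
  strongly connected one and cannot have more vertices.\<close>

lemma components_eq_sccs: "components G = sccs"
proof (intro equalityI subsetI)
  fix H assume "H \<in> components G"
  then have max: "max_subgraph connected H" by (simp add: components_def)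
  have "arc_mono connected"
    unfolding arc_mono_def
    using wf_digraph.connected_spanning_imp_connected by (metis spanning_def subgraph_def)
  then have ind: "induced_subgraph H G" using max by (intro induced_subgraphI_arc_mono)
  have "strongly_connected H"
    using strongly_connected_induced[of H] max induce_eq_iff_induced[OF ind]
    by (simp add: max_subgraph_def)
  moreover have "connected K" if "strongly_connected K" "subgraph K G" for K
    using that wf_digraph.strongly_connected_imp_connected by blast
  ultimately have "max_subgraph strongly_connected H"
    using max unfolding max_subgraph_def by blast
  then show "H \<in> sccs" using sccs_altdef2 by blast
next
  fix H assume H: "H \<in> sccs"
  then have ind: "induced_subgraph H G" and sc: "strongly_connected H" by auto
  have sub: "subgraph H G" using ind by auto
  have con: "connected H" using sc sub wf_digraph.strongly_connected_imp_connected by blast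
  have "max_subgraph connected H"
  proof (rule max_subgraphI[where P = connected, OF con sub])
    fix K assume K: "H \<noteq> K" "subgraph H K" "subgraph K G"
    show "\<not> connected K"
    proof
      assume "connected K"
      then have "strongly_connected (G \<restriction> verts K)" using K by (intro strongly_connected_induced)
      moreover have "induced_subgraph (G \<restriction> verts K) G" using K by auto
      moreover have "verts H \<subseteq> verts (G \<restriction> verts K)" using K by auto
      ultimately have v: "verts H = verts K"
        using H unfolding sccs_def psubset_eq by (metis (mono_tags, lifting) induce_subgraph_verts mem_Collect_eq)
      have "subgraph K (G \<restriction> verts K)" by (rule subgraph_induce_subgraphI2[OF K(3)])
      then have "arcs K \<subseteq> arcs H" using induce_eq_iff_induced[OF ind] v by (metis subgraphE)
      then have "K = H" using K v by (auto simp: subgraph_def compatible_def)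
      then show False using K by simp
    qed
  qed
  then show "H \<in> components G" by (simp add: components_def)
qed

lemma card_components: "card (components G) = card (scc_of ` verts G)"
  using components_eq_sccs card_sccs_verts sccs_verts_conv_scc_of by simp

lemma scc_of_eq: "scc_of u = {v. u \<rightarrow>\<^sup>* v}"
  unfolding scc_of_def using symmetric_reachable' by blast

lemma scc_of_cong: "u \<rightarrow>\<^sup>* v \<Longrightarrow> scc_of u = scc_of v"
  unfolding scc_of_eq using symmetric_reachable' reachable_trans by blast

end

section \<open>Bridges, small components and claws in simple graphs\<close>

context pair_graph
begin

lemma arc_sym: "(u, v) \<in> parcs G \<Longrightarrow> (v, u) \<in> parcs G"
  using graph_symmetric by simp

lemma pair_graph_del_edge: "pair_graph (del_edge G u v)"
proof
  show "symmetric (with_proj (del_edge G u v))"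
    using arc_sym unfolding symmetric_def del_edge_def by (auto intro!: symI)
qed (use wellformed' no_loops' finite_verts finite_arcs in \<open>auto simp: del_edge_def\<close>)

text \<open>Once the edge is deleted, \<open>S\<close> cannot be left, so \<open>u\<close> no longer
  reaches \<open>v\<close> and a component splits.\<close>

lemma bridge_of_singleton_cut:
  assumes "{e \<in> parcs G. fst e \<in> S \<and> snd e \<notin> S} = {(u, v)}"
  shows "bridge G u v"
proof -
  have "(u, v) \<in> {e \<in> parcs G. fst e \<in> S \<and> snd e \<notin> S}" unfolding assms by simp
  then have uv: "(u, v) \<in> parcs G" "u \<in> S" "v \<notin> S" by simp_all
  have V: "u \<in> pverts G" "v \<in> pverts G" using uv wellformed' by auto
  interpret D: pair_graph "del_edge G u v" by (rule pair_graph_del_edge)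
  let ?D = "del_edge G u v"
  have verts: "pverts ?D = pverts G" by (simp add: del_edge_def)
  have mono: "D.scc_of a \<subseteq> scc_of a" for a
  proof -
    have "subgraph (with_proj ?D) (with_proj G)"
    proof (rule subgraphI)
      show "wf_digraph (with_proj ?D)" "wf_digraph (with_proj G)" by unfold_locales
    qed (auto simp: del_edge_def)
    then have "a \<rightarrow>\<^sup>*\<^bsub>with_proj G\<^esub> b" if "a \<rightarrow>\<^sup>*\<^bsub>with_proj ?D\<^esub> b" for b
      using that by (rule pre_digraph.reachable_mono[rotated])
    then show ?thesis unfolding scc_of_eq D.scc_of_eq by blast
  qed
  \<comment> \<open>Sends each component after the deletion to the component of \<open>G\<close>
    containing it. The map is onto but identifies those of \<open>u\<close> and \<open>v\<close>,
    which forces the strict inequality.\<close>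
  define \<phi> where "\<phi> T = (\<Union>a\<in>T. scc_of a)" for T
  have \<phi>: "\<phi> (D.scc_of a) = scc_of a" if "a \<in> pverts G" for a
  proof -
    have "scc_of b = scc_of a" if "b \<in> D.scc_of a" for b
      using that mono scc_of_cong[of a b] unfolding scc_of_eq by blast
    moreover have "a \<in> D.scc_of a" using that verts unfolding D.scc_of_eq by simp
    ultimately show ?thesis unfolding \<phi>_def by blast
  qed
  let ?A = "D.scc_of ` pverts G"
  have im: "\<phi> ` ?A = scc_of ` pverts G" using \<phi> by (force simp: image_image)
  have fin: "finite ?A" using finite_verts by simp
  have "w \<in> S" if "u \<rightarrow>\<^sup>*\<^bsub>with_proj ?D\<^esub> w" for w
    using that
  proof (induction rule: D.reachable_induct)
    case base
    then show ?case using uv by simp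
  next
    case (step x y)
    then have xy: "(x, y) \<in> parcs G" "(x, y) \<notin> {(u, v)}" by (auto simp: del_edge_def)
    then show ?case using step unfolding assms[symmetric] by simp
  qed
  then have "v \<notin> D.scc_of u" using uv unfolding D.scc_of_eq by blast
  moreover have "v \<in> D.scc_of v" using V verts unfolding D.scc_of_eq by simp
  ultimately have ne: "D.scc_of u \<noteq> D.scc_of v" by blast
  have "scc_of u = scc_of v" using uv by (intro scc_of_cong) auto
  then have "\<not> inj_on \<phi> ?A" using ne \<phi> V by (metis imageI inj_onD)
  then have "card (\<phi> ` ?A) < card ?A"
    using card_image_le[OF fin, of \<phi>] eq_card_imp_inj_on[OF fin, of \<phi>] by linarith
  then show ?thesis unfolding bridge_def using uv(1) im card_components D.card_components verts by simp
qed

text \<open>A walk inside \<open>S\<close> from \<open>a\<close> can only alternate between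
  \<open>a\<close> and its unique neighbour in \<open>S\<close>.\<close>

lemma card_component_le_2:
  assumes S: "S \<subseteq> pverts G" and C: "C \<in> components (with_proj G \<restriction> S)"
    and uniq: "\<And>v w w'. \<lbrakk>v \<in> S; w \<in> S; w' \<in> S; (v, w) \<in> parcs G; (v, w') \<in> parcs G\<rbrakk> \<Longrightarrow> w = w'"
  shows "card (verts C) \<le> 2"
proof -
  let ?H = "with_proj G \<restriction> S"
  have adj: "(v, w) \<in> arcs_ends ?H \<longleftrightarrow> v \<in> S \<and> w \<in> S \<and> (v, w) \<in> parcs G" for v w
    by (auto simp: arcs_ends_conv)
  have "induced_subgraph ?H (with_proj G)" using S by (intro induced_induce) simp
  then interpret H: sym_digraph ?H by (rule induced_graph_imp_graph)
  have "verts C \<in> H.sccs_verts"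
    using C H.components_eq_sccs H.sccs_verts_conv by blast
  then obtain a where a: "a \<in> S" "verts C = H.scc_of a"
    using H.sccs_verts_conv_scc_of by auto
  have "w \<in> insert a {w \<in> S. (a, w) \<in> parcs G}" if "a \<rightarrow>\<^sup>*\<^bsub>?H\<^esub> w" for w
    using that
  proof (induction rule: H.reachable_induct)
    case base
    then show ?case by simp
  next
    case (step x y)
    then have xy: "x \<in> S" "y \<in> S" "(x, y) \<in> parcs G" using adj by blast+
    show ?case
    proof (cases "x = a")
      case True
      then show ?thesis using xy by simp
    next
      case False
      \<comment> \<open>\<open>x\<close> is a neighbour of \<open>a\<close>, and its only neighbour
        in \<open>S\<close> is \<open>a\<close>, so the walk must turn back.\<close>
      then have "(x, a) \<in> parcs G" using step arc_sym by blast
      then have "y = a" using uniq xy a by blast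
      then show ?thesis by simp
    qed
  qed
  then have sub: "verts C \<subseteq> insert a {w \<in> S. (a, w) \<in> parcs G}"
    unfolding a(2) H.scc_of_eq by blast
  obtain b where "{w \<in> S. (a, w) \<in> parcs G} \<subseteq> {b}"
    using uniq a(1) by (metis (mono_tags, lifting) mem_Collect_eq insertI1 subsetI)
  then have "verts C \<subseteq> {a, b}" using sub by blast
  then have "card (verts C) \<le> card {a, b}" by (intro card_mono) auto
  also have "\<dots> \<le> 2" by (simp add: card_insert_if)
  finally show ?thesis .
qed

text \<open>If \<open>x\<close>, \<open>y\<close>, \<open>z\<close> were pairwise non-adjacent, the
  star at \<open>v\<close> would be an induced claw.\<close>

lemma claw_free_neighbours:
  assumes "claw_free (with_proj G)" "(v, x) \<in> parcs G" "(v, y) \<in> parcs G" "(v, z) \<in> parcs G"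
    and "distinct [x, y, z]"
  shows "(x, y) \<in> parcs G \<or> (y, z) \<in> parcs G \<or> (x, z) \<in> parcs G"
proof (rule ccontr)
  assume neg: "\<not> ?thesis"
  define H where "H = \<lparr>pverts = {v, x, y, z}, parcs = {v} \<times> {x, y, z} \<union> {x, y, z} \<times> {v}\<rparr>"
  have ne: "v \<noteq> x" "v \<noteq> y" "v \<noteq> z" using assms no_loops' by blast+
  have V: "{v, x, y, z} \<subseteq> pverts G" using assms wellformed' by blast
  have s: "(x, v) \<in> parcs G" "(y, v) \<in> parcs G" "(z, v) \<in> parcs G" using assms arc_sym by blast+
  have n: "(y, x) \<notin> parcs G" "(z, y) \<notin> parcs G" "(z, x) \<notin> parcs G" using neg arc_sym by blast+
  have irr: "(w, w) \<notin> parcs G" for w using no_loops' by blast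
  have "induced_subgraph (with_proj H) (with_proj G)"
  proof (intro induced_subgraphI subgraphI)
    show "wf_digraph (with_proj H)" unfolding wf_digraph_wp_iff
      by unfold_locales (auto simp: H_def)
    show "wf_digraph (with_proj G)" by unfold_locales
    show "verts (with_proj H) \<subseteq> verts (with_proj G)" using V by (simp add: H_def)
    show "arcs (with_proj H) \<subseteq> arcs (with_proj G)" using assms s by (auto simp: H_def)
    show "arcs (with_proj H) =
        {e \<in> arcs (with_proj G). tail (with_proj G) e \<in> verts (with_proj H) \<and> head (with_proj G) e \<in> verts (with_proj H)}"
      (is "_ = ?R")
    proof (intro equalityI subsetI)
      fix e assume "e \<in> arcs (with_proj H)"
      then show "e \<in> ?R" using assms(2-4) s by (auto simp: H_def)
    next
      fix e assume e: "e \<in> ?R"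
      obtain p q where pq: "e = (p, q)" by fastforce
      then have pq': "(p, q) \<in> parcs G" "p \<in> {v, x, y, z}" "q \<in> {v, x, y, z}"
        using e by (auto simp: H_def)
      then have "\<not> (p \<in> {x, y, z} \<and> q \<in> {x, y, z})" "\<not> (p = v \<and> q = v)"
        using neg n irr by blast+
      then show "e \<in> arcs (with_proj H)" using pq pq' by (simp add: H_def) blast
    qed
  qed auto
  moreover have "K\<^bsub>1,3\<^esub> (with_proj H)"
    unfolding complete_bipartite_digraph_pair_def
    by (intro conjI exI[of _ "{v}"] exI[of _ "{x, y, z}"]) (use assms ne in \<open>auto simp: H_def\<close>)
  ultimately show False using assms(1) unfolding claw_free_def by blast
qed

end

theorem theorem2p2:
  fixes G :: "'a pair_pre_digraph"
  assumes "pair_graph G"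
    and "bridgeless G"
    and "claw_free (with_proj G)"
    and "cubic (with_proj G)"
  shows "\<exists>B W. bisection 2 (with_proj G) B W"
proof -
  interpret pair_graph G by (rule assms(1))
  interpret claw_free_cubic "pverts G" "parcs G"
  proof
    show "finite (pverts G)" by simp
    show "parcs G \<subseteq> pverts G \<times> pverts G" using wellformed' by auto
    show "(w, v) \<in> parcs G" if "(v, w) \<in> parcs G" for v w using that by (rule arc_sym)
    show "(v, v) \<notin> parcs G" for v using no_loops' by blast
    show "card (parcs G `` {v}) = 3" if "v \<in> pverts G" for v
    proof -
      have "parcs G `` {v} = snd ` out_arcs (with_proj G) v" by force
      moreover have "inj_on snd (out_arcs (with_proj G) v)" by (auto intro!: inj_onI)
      ultimately show ?thesis
        using assms(4) that by (simp add: card_image cubic_def out_degree_def)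
    qed
    show "(x, y) \<in> parcs G \<or> (y, z) \<in> parcs G \<or> (x, z) \<in> parcs G"
      if "(v, x) \<in> parcs G" "(v, y) \<in> parcs G" "(v, z) \<in> parcs G" "distinct [x, y, z]" for v x y z
      using claw_free_neighbours[OF assms(3) that] .
    show "card {e \<in> parcs G. fst e \<in> S \<and> snd e \<notin> S} \<noteq> 1" for S
    proof
      assume "card {e \<in> parcs G. fst e \<in> S \<and> snd e \<notin> S} = 1"
      then obtain e where "{e \<in> parcs G. fst e \<in> S \<and> snd e \<notin> S} = {e}"
        by (rule card_1_singletonE)
      then show False
        using bridge_of_singleton_cut[of S "fst e" "snd e"] assms(2) unfolding bridgeless_def by simp
    qed
  qed
  obtain c where bal: "(\<Sum>v\<in>pverts G. spin (c v)) = 0"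
    and uniq: "\<And>v w w'. \<lbrakk>(v, w) \<in> parcs G; (v, w') \<in> parcs G; c w = c v; c w' = c v\<rbrakk> \<Longrightarrow> w = w'"
    using balanced_colouring by blast
  define B W where "B = {v \<in> pverts G. c v}" and "W = {v \<in> pverts G. \<not> c v}"
  have "(\<Sum>v\<in>pverts G. spin (c v)) = (\<Sum>v\<in>B. 1) + (\<Sum>v\<in>W. -1)"
    unfolding spin_def B_def W_def by (simp add: sum.If_cases Int_def)
  then have "card B = card W" using bal by simp
  moreover have "card (verts C) \<le> 2" if "C \<in> components (with_proj G \<restriction> B)" for C
    by (rule card_component_le_2[OF _ that]) (use uniq in \<open>auto simp: B_def\<close>)
  moreover have "card (verts C) \<le> 2" if "C \<in> components (with_proj G \<restriction> W)" for C
    by (rule card_component_le_2[OF _ that]) (use uniq in \<open>auto simp: W_def\<close>)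
  moreover have "B \<union> W = pverts G" "B \<inter> W = {}" unfolding B_def W_def by auto
  ultimately show ?thesis unfolding bisection_def by auto
qed

end
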